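(* Let $1<p<\infty$. Then for any $g\in L^p[0,1]$ (and any $m\in\mathbb{N}$), $$\Vert g-G_m^p(g,\mathcal{H})\Vert_p\le\left(2+\frac{1}{\left(1-\left(\frac12\right)^{1/p}\right)^2}\right)\cdot\left(\max\left(p,\frac{p}{p-1}\right)-1\right)^2\cdot\sigma_m(g)_p .$$
   Context: $\mathcal{H}=\{H_I\}_I$ is the Haar basis of $L^p[0,1]$. It is indexed by the dyadic intervals $I=[(j-1)2^{-n},j2^{-n})$, $n=0,1,2,\dots$, $j=1,\dots,2^n$, together with one further index $I=[0,1]$ (regarded as distinct from $[0,1)$). Here $H_{[0,1]}(x)=1$ for $x\in[0,1)$, and $H_{[(j-1)2^{-n},j2^{-n})}(x)$ equals $2^{n/2}$ for $x\in[(j-1)2^{-n},(j-\frac12)2^{-n})$, equals $-2^{n/2}$ for $x\in[(j-\frac12)2^{-n},j2^{-n})$, and equals $0$ otherwise. These indices $I$ are all called dyadic intervals. For $f\in L^p[0,1]$ put $c_I(f):=(f,H_I)=\int_0^1 f(x)H_I(x)\,dx$ and $c_I(f,p):=\Vert c_I(f)H_I\Vert_p$, where $\Vert\cdot\Vert_p$ is the norm of $L^p[0,1]$. Greedy algorithm: $\Lambda_m=\Lambda_m(f,p)$ denotes a set of $m$ dyadic intervals such that $\min_{I\in\Lambda_m}c_I(f,p)\ge\max_{J\notin\Lambda_m}c_J(f,p)$, and $G_m^p(f,\mathcal{H}):=\sum_{I\in\Lambda_m}c_I(f)H_I$. $\sigma_m(g)_p$ is the error of best $m$-term approximation of $g$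 from $\mathcal{H}$ in $L^p[0,1]$: the infimum of $\Vert g-\sum_{I\in\Lambda}a_IH_I\Vert_p$ over all sets $\Lambda$ of $m$ dyadic intervals and all scalars $a_I$. *)

theory Defs
  imports "HOL-Analysis.Analysis"
begin

abbreviation unit_measure :: "real measure" where
  "unit_measure \<equiv> lebesgue_on {0..1}"

text \<open>Real-valued functions, not a.e.-equivalence classes; \<open>Lp_norm\<close> is meaningful
  only on \<open>Lp_space\<close>.\<close>

definition Lp_space :: "real \<Rightarrow> (real \<Rightarrow> real) set" where
  "Lp_space p = {f \<in> borel_measurable unit_measure. integrable unit_measure (\<lambda>x. \<bar>f x\<bar> powr p)}"

definition Lp_norm :: "real \<Rightarrow> (real \<Rightarrow> real) \<Rightarrow> real" where
  "Lp_norm p f = (LINT x|unit_measure. \<bar>f x\<bar> powr p) powr (1 / p)"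

text \<open>\<open>Dyadic n j\<close> stands for the interval $[(j-1)2^{-n}, j2^{-n})$; \<open>Whole\<close> is the extra
  index $[0,1]$ of the constant function. Only the elements of \<open>dyadic_intervals\<close> are indices
  of the Haar basis.\<close>

datatype haar_index = Whole | Dyadic nat nat

definition dyadic_intervals :: "haar_index set" where
  "dyadic_intervals = insert Whole {Dyadic n j | n j. 1 \<le> j \<and> j \<le> 2 ^ n}"

fun haar :: "haar_index \<Rightarrow> real \<Rightarrow> real" where
  "haar Whole x = (if x \<in> {0..<1} then 1 else 0)"
| "haar (Dyadic n j) x =
     (if x \<in> {(real j - 1) / 2 ^ n ..< (real j - 1 / 2) / 2 ^ n} then 2 powr (real n / 2)
      else if x \<in> {(real j - 1 / 2) / 2 ^ n ..< real j / 2 ^ n} then - (2 powr (real n / 2))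
      else 0)"

definition haar_coeff :: "(real \<Rightarrow> real) \<Rightarrow> haar_index \<Rightarrow> real" where
  "haar_coeff f I = (LINT x|unit_measure. f x * haar I x)"

definition haar_coeff_norm :: "real \<Rightarrow> (real \<Rightarrow> real) \<Rightarrow> haar_index \<Rightarrow> real" where
  "haar_coeff_norm p f I = Lp_norm p (\<lambda>x. haar_coeff f I * haar I x)"

text \<open>Ties may make the greedy set non-unique, so it is a predicate on \<open>\<Lambda>\<close>.\<close>

definition greedy_set :: "real \<Rightarrow> (real \<Rightarrow> real) \<Rightarrow> nat \<Rightarrow> haar_index set \<Rightarrow> bool" where
  "greedy_set p f m \<Lambda> \<longleftrightarrow>
     \<Lambda> \<subseteq> dyadic_intervals \<and> finite \<Lambda> \<and> card \<Lambda> = m \<and>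
     (\<forall>I \<in> \<Lambda>. \<forall>J \<in> dyadic_intervals - \<Lambda>. haar_coeff_norm p f I \<ge> haar_coeff_norm p f J)"

definition greedy_approx :: "(real \<Rightarrow> real) \<Rightarrow> haar_index set \<Rightarrow> real \<Rightarrow> real" where
  "greedy_approx f \<Lambda> x = (\<Sum>I\<in>\<Lambda>. haar_coeff f I * haar I x)"

definition best_mterm_error :: "real \<Rightarrow> nat \<Rightarrow> (real \<Rightarrow> real) \<Rightarrow> real" where
  "best_mterm_error p m g =
     Inf {Lp_norm p (\<lambda>x. g x - (\<Sum>I\<in>\<Lambda>. a I * haar I x)) | \<Lambda> a.
            \<Lambda> \<subseteq> dyadic_intervals \<and> finite \<Lambda> \<and> card \<Lambda> = m}"

end

theory Submission
  imports Defs
begin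

text \<open>Burkholder's function, which is midpoint concave in the directions \<open>(h, \<plusminus>h)\<close>, shows that sign
  changes of the Haar coefficients have norm at most \<open>C = max p (p / (p - 1)) - 1\<close>. Let \<open>B\<close> be
  a competing set of \<open>m\<close> indices, \<open>h = g - (\<Sum>I\<in>B. a I * haar I)\<close>, and write
  \<open>g - G = (h - S h) + S' g\<close>, where \<open>S\<close> projects on \<open>\<Lambda> \<union> B\<close> and \<open>S'\<close> on \<open>B - \<Lambda>\<close>. The first term has
  norm at most \<open>(1 + C) \<parallel>h\<parallel>\<close>. Put \<open>z = 2 powr (1 / p)\<close>. The terms of \<open>S' g\<close> have norm at most some \<open>\<mu>\<close>,
  and summing geometric series along chains of nested intervals gives
  \<open>\<parallel>S' g\<parallel> \<le> z / (z - 1) * \<mu> * card (B - \<Lambda>) powr (1 / p)\<close>. On \<open>\<Lambda> - B\<close>, which is equinumerous,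
  the coefficients of \<open>g\<close> and \<open>h\<close> agree and the terms have norm at least \<open>\<mu>\<close>; averaging over all signs gives
  \<open>\<mu> * card (\<Lambda> - B) powr (1 / p) \<le> z * C * \<parallel>h\<parallel>\<close>. Finally \<open>z \<le> z / (z - 1)\<close>.\<close>

section \<open>Convexity inequalities\<close>

text \<open>Convexity of \<open>\<bar>y\<bar> powr p\<close> in the form of a subgradient at
  \<open>v\<close>. Integrating or averaging this line gives all Jensen-type inequalities
  below.\<close>

lemma abs_powr_supporting_line:
  fixes p v :: real
  assumes "1 < p"
  shows "\<exists>m. \<forall>y. \<bar>v\<bar> powr p + m * (y - v) \<le> \<bar>y\<bar> powr p"
proof -
  have pos: "v powr p + p * v powr (p - 1) * (y - v) \<le> \<bar>y\<bar> powr p" if "0 < v" for v y :: real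
  proof (cases "0 < y")
    case True
    have "p * v powr (p - 1) * (y - v) \<le> y powr p - v powr p"
      using assms that True
      by (intro f''_imp_f'[where C = "{0<..}" and f'' = "\<lambda>x. p * ((p - 1) * x powr (p - 1 - 1))"])
        (auto intro!: derivative_eq_intros)
    then show ?thesis using True by simp
  next
    case False
    \<comment> \<open>For \<open>y \<le> 0\<close> the tangent at \<open>v\<close> has already
      dropped to at most \<open>(1 - p) * v powr p\<close>, which is nonpositive.\<close>
    have "p * v powr (p - 1) * (y - v) \<le> p * v powr (p - 1) * (- v)"
      using False assms that by (intro mult_left_mono) auto
    also have "\<dots> = - p * v powr p"
      using that powr_mult_base[of v "p - 1"] by (simp add: mult_ac)
    finally have "v powr p + p * v powr (p - 1) * (y - v) \<le> (1 - p) * v powr p"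
      by (simp add: algebra_simps)
    also have "\<dots> \<le> 0" using assms by (simp add: mult_nonpos_nonneg)
    also have "0 \<le> \<bar>y\<bar> powr p" by simp
    finally show ?thesis .
  qed
  consider "v > 0" | "v = 0" | "v < 0" by linarith
  then show ?thesis
  proof cases
    case 1
    then show ?thesis using pos[of v] by (intro exI[of _ "p * v powr (p - 1)"]) auto
  next
    case 2
    then show ?thesis by (intro exI[of _ 0]) auto
  next
    case 3
    have "\<bar>v\<bar> powr p + - (p * \<bar>v\<bar> powr (p - 1)) * (y - v) \<le> \<bar>y\<bar> powr p" for y
      using pos[of "- v" "- y"] 3 by (simp add: algebra_simps)
    then show ?thesis by blast
  qed
qed

lemma abs_powr_midpoint:
  fixes p u v :: real
  assumes "1 < p"
  shows "2 * \<bar>(u + v) / 2\<bar> powr p \<le> \<bar>u\<bar> powr p + \<bar>v\<bar> powr p"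
proof -
  define s where "s = (u + v) / 2"
  obtain m where m: "\<And>y. \<bar>s\<bar> powr p + m * (y - s) \<le> \<bar>y\<bar> powr p"
    using abs_powr_supporting_line[OF assms, of s] by blast
  have "m * (u - s) + m * (v - s) = 0"
    by (simp add: s_def field_simps)
  then show ?thesis using m[of u] m[of v] by (simp add: s_def[symmetric])
qed

text \<open>To the left of 0, \<open>f\<close> is convex with value and slope 0 at 0. To the right,
  a negative value at \<open>x\<close> forces \<open>f''\<close> to be negative somewhere before
  \<open>x\<close>. By monotonicity it stays negative, so \<open>f'\<close> stays negative as well
  and \<open>f\<close> could not recover to \<open>0 \<le> f r\<close>.\<close>

lemma nonneg_if_second_derivative_antimono:
  fixes f f' f'' :: "real \<Rightarrow> real"
  assumes cont: "continuous_on {l..r} f" and "l < 0" "0 < r"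
    and f': "\<And>x. l < x \<Longrightarrow> x < r \<Longrightarrow> (f has_real_derivative f' x) (at x)"
    and f'': "\<And>x. l < x \<Longrightarrow> x < r \<Longrightarrow> (f' has_real_derivative f'' x) (at x)"
    and zero: "f 0 = 0" "f' 0 = 0" and r: "0 \<le> f r"
    and convex_left: "\<And>x. l < x \<Longrightarrow> x \<le> 0 \<Longrightarrow> 0 \<le> f'' x"
    and antimono: "\<And>x y. 0 < x \<Longrightarrow> x \<le> y \<Longrightarrow> y < r \<Longrightarrow> f'' y \<le> f'' x"
    and x: "l \<le> x" "x \<le> r"
  shows "0 \<le> f x"
proof -
  \<comment> \<open>At the endpoints \<open>l\<close> and \<open>r\<close> only continuity of
    \<open>f\<close> is available, so the mean value theorem is used in its version for functions
    differentiable in the open interval.\<close>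
  have mvt: "\<exists>z. a < z \<and> z < b \<and> f b - f a = (b - a) * f' z" if "l \<le> a" "a < b" "b \<le> r" for a b
  proof -
    have "continuous_on {a..b} f"
      using that by (intro continuous_on_subset[OF cont]) auto
    then have "\<exists>t z. a < z \<and> z < b \<and> (f has_real_derivative t) (at z) \<and> f b - f a = (b - a) * t"
      using that by (intro MVT) (auto simp: real_differentiable_def intro!: exI f')
    then obtain t z where z: "a < z" "z < b" "(f has_real_derivative t) (at z)"
      "f b - f a = (b - a) * t" by blast
    then have "t = f' z" using f'[of z] that by (intro DERIV_unique[of f t z]) auto
    then show ?thesis using z by blast
  qed
  have mvt': "\<exists>z. a < z \<and> z < b \<and> f' b - f' a = (b - a) * f'' z" if "l < a" "a < b" "b < r" for a b
    using that by (intro MVT2) (auto intro!: f'')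
  consider "x < 0" | "x = 0" | "0 < x" by linarith
  then show ?thesis
  proof cases
    case 1
    obtain z where z: "x < z" "z < 0" "f 0 - f x = (0 - x) * f' z"
      using mvt[of x 0] 1 x \<open>0 < r\<close> by auto
    obtain w where w: "z < w" "w < 0" "f' 0 - f' z = (0 - z) * f'' w"
      using mvt'[of z 0] z x \<open>0 < r\<close> by auto
    have "0 \<le> (0 - z) * f'' w" using convex_left[of w] w z x by (intro mult_nonneg_nonneg) auto
    then have "f' z \<le> 0" using w zero by simp
    then have "(0 - x) * f' z \<le> 0" using 1 by (intro mult_nonneg_nonpos) auto
    then show ?thesis using z zero by simp
  next
    case 2
    then show ?thesis using zero by simp
  next
    case 3
    show ?thesis
    proof (rule ccontr)
      assume "\<not> 0 \<le> f x"
      then have neg: "f x < 0" by simp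
      then have "x < r" using x r by (cases "x = r") auto
      obtain z where z: "0 < z" "z < x" "f x - f 0 = (x - 0) * f' z"
        using mvt[of 0 x] 3 \<open>l < 0\<close> \<open>x < r\<close> by auto
      have "f' z < 0" using z neg zero 3 by (simp add: mult_less_0_iff)
      obtain w where w: "0 < w" "w < z" "f' z - f' 0 = (z - 0) * f'' w"
        using mvt'[of 0 z] z \<open>l < 0\<close> \<open>x < r\<close> by auto
      have "f'' w < 0" using w \<open>f' z < 0\<close> zero z(1) by (simp add: mult_less_0_iff)
      obtain v where v: "x < v" "v < r" "f r - f x = (r - x) * f' v"
        using mvt[of x r] 3 \<open>l < 0\<close> \<open>x < r\<close> by auto
      obtain u where u: "z < u" "u < v" "f' v - f' z = (v - z) * f'' u"
        using mvt'[of z v] z v \<open>l < 0\<close> by auto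
      have "f'' u < 0" using antimono[of w u] w u v z \<open>f'' w < 0\<close> by auto
      then have "(v - z) * f'' u < 0" using u by (intro mult_pos_neg) auto
      then have "f' v < 0" using u \<open>f' z < 0\<close> by simp
      then have "(r - x) * f' v < 0" using \<open>x < r\<close> by (intro mult_pos_neg) auto
      then show False using v r neg by simp
    qed
  qed
qed

text \<open>The value at \<open>d = 1\<close> of the function \<open>f\<close> of \<open>powr_difference_tangent\<close>; both cases are weighted
  AM-GM with the weights \<open>p - 1\<close> and \<open>2 - p\<close>, resp. \<open>1 / (p - 1)\<close> and \<open>(p - 2) / (p - 1)\<close>.\<close>

lemma conjugate_powr_le:
  fixes p :: real
  assumes "2 \<le> p"
  shows "(p / (p - 1)) powr p \<le> p\<^sup>2 / (p - 1)"
proof -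
  have "p powr ((p - 2) / (p - 1)) * 1 powr (1 / (p - 1)) \<le> (p - 2) / (p - 1) * p + 1 / (p - 1) * 1"
    using assms by (intro Youngs_inequality_0) (auto simp: field_simps)
  also have "\<dots> = p - 1"
    using assms by (simp add: field_simps)
  finally have "(p powr ((p - 2) / (p - 1))) powr (p - 1) \<le> (p - 1) powr (p - 1)"
    using assms by (intro powr_mono2) auto
  then have *: "p powr (p - 2) \<le> (p - 1) powr (p - 1)"
    using assms by (simp add: powr_powr)
  have "p powr p = p powr (p - 2) * p\<^sup>2"
    using assms by (simp add: powr_diff powr_numeral)
  also have "\<dots> \<le> (p - 1) powr (p - 1) * p\<^sup>2"
    using * by (intro mult_right_mono) auto
  also have "\<dots> = (p - 1) powr p * (p\<^sup>2 / (p - 1))"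
    using assms by (simp add: powr_diff)
  finally show ?thesis
    using assms by (simp add: powr_divide divide_le_eq mult_ac)
qed

lemma conjugate_powr_ge:
  fixes p :: real
  assumes "1 < p" "p \<le> 2"
  shows "p\<^sup>2 / (p - 1) \<le> (p / (p - 1)) powr p"
proof -
  have "(p - 1) powr (p - 1) * p powr (2 - p) \<le> (p - 1) * (p - 1) + (2 - p) * p"
    using assms by (intro Youngs_inequality_0) auto
  also have "\<dots> = 1" by (simp add: algebra_simps)
  finally have "(p - 1) powr (p - 1) * p powr (2 - p) * p powr p \<le> 1 * p powr p"
    by (intro mult_right_mono) auto
  moreover have "p powr (2 - p) * p powr p = p\<^sup>2"
    using assms by (simp flip: powr_add add: powr_numeral)
  ultimately have "(p - 1) powr p * (p\<^sup>2 / (p - 1)) \<le> p powr p"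
    using assms by (simp add: powr_diff mult_ac)
  then show ?thesis
    using assms by (simp add: powr_divide le_divide_eq mult_ac)
qed

text \<open>The one-variable form of Burkholder's comparison. The coefficient
  \<open>p\<^sup>2 / (p - 1)\<close> is the derivative at 0 of the difference of powers, so
  \<open>f\<close> vanishes to second order there. For \<open>p \<ge> 2\<close> the criterion above
  applies to \<open>- f\<close>, for \<open>p \<le> 2\<close> to \<open>f\<close>. Both bases are
  nonnegative exactly on the stated range of \<open>d\<close>.\<close>

lemma powr_difference_tangent:
  fixes p d :: real
  assumes p: "1 < p" and d: "- (p - 1) \<le> d" "d \<le> 1"
  defines "f \<equiv> \<lambda>d. (1 + d / (p - 1)) powr p - (1 - d) powr p - p\<^sup>2 / (p - 1) * d"
  shows "2 \<le> p \<Longrightarrow> f d \<le> 0" and "p \<le> 2 \<Longrightarrow> 0 \<le> f d"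
proof -
  define f' where "f' = (\<lambda>d. p / (p - 1) * (1 + d / (p - 1)) powr (p - 1)
    + p * (1 - d) powr (p - 1) - p\<^sup>2 / (p - 1))"
  define f'' where "f'' = (\<lambda>d. p / (p - 1) * (1 + d / (p - 1)) powr (p - 2)
    - p * (p - 1) * (1 - d) powr (p - 2))"
  have arg: "0 < 1 + x / (p - 1)" if "- (p - 1) < x" for x
    using that p by (simp add: field_simps)
  have pow_left: "((\<lambda>d. (1 + d / (p - 1)) powr r) has_real_derivative
      r * (1 + x / (p - 1)) powr (r - 1) * (1 / (p - 1))) (at x)" if "- (p - 1) < x" for x r
  proof -
    have "((\<lambda>d. 1 + d / (p - 1)) has_real_derivative 1 / (p - 1)) (at x)"
      using DERIV_add[OF DERIV_const DERIV_cdivide[OF DERIV_ident]] by fastforce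
    from DERIV_fun_powr[OF this arg[OF that], of r] show ?thesis by simp
  qed
  have pow_right: "((\<lambda>d. (1 - d) powr r) has_real_derivative
      r * (1 - x) powr (r - 1) * (- 1)) (at x)" if "x < 1" for x r :: real
    using that by (auto intro!: derivative_eq_intros)
  have df: "(f has_real_derivative f' x) (at x)" if "- (p - 1) < x" "x < 1" for x
    unfolding f_def f'_def
    by (rule DERIV_cong[OF DERIV_diff[OF DERIV_diff[OF pow_left pow_right] DERIV_cmult[OF DERIV_ident]]])
      (use that in auto)
  have df': "(f' has_real_derivative f'' x) (at x)" if "- (p - 1) < x" "x < 1" for x
    unfolding f'_def f''_def
    by (rule DERIV_cong[OF DERIV_diff[OF DERIV_add[OF DERIV_cmult[OF pow_left] DERIV_cmult[OF pow_right]]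
            DERIV_const]]) (use that p in auto)
  have arg0: "0 \<le> 1 + x / (p - 1)" if "- (p - 1) \<le> x" for x
    using that p by (simp add: field_simps)
  have cont: "continuous_on {- (p - 1)..1} f"
    unfolding f_def using p arg0 by (auto intro!: continuous_intros continuous_on_powr')
  have zero: "f 0 = 0" "f' 0 = 0"
    using p by (auto simp: f_def f'_def field_simps power2_eq_square)
  have f1: "f 1 = (p / (p - 1)) powr p - p\<^sup>2 / (p - 1)"
    using p by (simp add: f_def field_simps)
  show "f d \<le> 0" if "2 \<le> p"
  proof -
    have "0 \<le> - f d"
    proof (rule nonneg_if_second_derivative_antimono[where f = "\<lambda>x. - f x" and f' = "\<lambda>x. - f' x"
          and f'' = "\<lambda>x. - f'' x" and x = d and l = "- (p - 1)" and r = 1])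
      show "0 \<le> - f 1" using conjugate_powr_le[OF that] f1 by simp
      show "0 \<le> - f'' x" if "- (p - 1) < x" "x \<le> 0" for x
      proof -
        have "(1 + x / (p - 1)) powr (p - 2) \<le> (1 - x) powr (p - 2)"
          using arg[of x] that p \<open>2 \<le> p\<close> divide_nonpos_pos[of x "p - 1"]
          by (intro powr_mono2) auto
        moreover have "p / (p - 1) \<le> p * (p - 1)"
        proof -
          have "1 * 1 \<le> (p - 1) * (p - 1)" using \<open>2 \<le> p\<close> by (intro mult_mono) auto
          then have "p * 1 \<le> p * ((p - 1) * (p - 1))" using p by (intro mult_left_mono) auto
          then show ?thesis using p by (simp add: divide_le_eq mult_ac)
        qed
        ultimately have "p / (p - 1) * (1 + x / (p - 1)) powr (p - 2)
            \<le> p * (p - 1) * (1 - x) powr (p - 2)"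
          using p by (intro mult_mono) auto
        then show ?thesis by (simp add: f''_def)
      qed
      show "- f'' y \<le> - f'' x" if "0 < x" "x \<le> y" "y < 1" for x y
      proof -
        have "(1 + x / (p - 1)) powr (p - 2) \<le> (1 + y / (p - 1)) powr (p - 2)"
          "(1 - y) powr (p - 2) \<le> (1 - x) powr (p - 2)"
          using that \<open>2 \<le> p\<close> by (auto intro!: powr_mono2 divide_right_mono)
        then have "p / (p - 1) * (1 + x / (p - 1)) powr (p - 2)
             \<le> p / (p - 1) * (1 + y / (p - 1)) powr (p - 2)"
          "p * (p - 1) * (1 - y) powr (p - 2) \<le> p * (p - 1) * (1 - x) powr (p - 2)"
          using p by (auto intro!: mult_left_mono divide_right_mono)
        then show ?thesis by (simp add: f''_def)
      qed
    qed (use p d zero df df' cont in \<open>auto intro!: continuous_intros derivative_intros\<close>)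
    then show ?thesis by simp
  qed
  show "0 \<le> f d" if "p \<le> 2"
  proof (rule nonneg_if_second_derivative_antimono[where f = f and f' = f' and f'' = f'' and x = d and l = "- (p - 1)" and r = 1])
    show "0 \<le> f 1" using conjugate_powr_ge[OF p that] f1 by simp
    show "0 \<le> f'' x" if "- (p - 1) < x" "x \<le> 0" for x
    proof -
      have "(1 - x) powr (p - 2) \<le> (1 + x / (p - 1)) powr (p - 2)"
        using arg[of x] that p \<open>p \<le> 2\<close> divide_nonpos_pos[of x "p - 1"]
        by (intro powr_mono2') auto
      moreover have "p * (p - 1) \<le> p / (p - 1)"
      proof -
        have "(p - 1) * (p - 1) \<le> 1 * 1" using \<open>p \<le> 2\<close> p by (intro mult_mono) auto
        then have "p * ((p - 1) * (p - 1)) \<le> p * 1" using p by (intro mult_left_mono) auto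
        then show ?thesis using p by (simp add: le_divide_eq mult_ac)
      qed
      ultimately have "p * (p - 1) * (1 - x) powr (p - 2)
          \<le> p / (p - 1) * (1 + x / (p - 1)) powr (p - 2)"
        using p by (intro mult_mono) auto
      then show ?thesis by (simp add: f''_def)
    qed
    show "f'' y \<le> f'' x" if "0 < x" "x \<le> y" "y < 1" for x y
    proof -
      have "(1 + y / (p - 1)) powr (p - 2) \<le> (1 + x / (p - 1)) powr (p - 2)"
        "(1 - x) powr (p - 2) \<le> (1 - y) powr (p - 2)"
        using that \<open>p \<le> 2\<close> p by (auto intro!: powr_mono2' divide_right_mono add_pos_nonneg)
      then have "p / (p - 1) * (1 + y / (p - 1)) powr (p - 2)
           \<le> p / (p - 1) * (1 + x / (p - 1)) powr (p - 2)"
        "p * (p - 1) * (1 - x) powr (p - 2) \<le> p * (p - 1) * (1 - y) powr (p - 2)"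
        using p by (auto intro!: mult_left_mono divide_right_mono)
      then show ?thesis by (simp add: f''_def)
    qed
  qed (use p d zero df df' cont in auto)
qed

section \<open>Burkholder's function\<close>

text \<open>On \<open>s \<ge> 0\<close> the function \<open>\<psi>\<close> is convex, with
  \<open>\<psi> 0 = 0\<close> and nonnegative slope at 0. Hence its continuation by 0 to negative
  arguments, which is \<open>\<psi> (max s 0)\<close>, is convex on the whole line. Both the slope
  at 0 and the sign of \<open>\<psi>''\<close> are governed by
  \<open>e + (p - 2) * c\<close>.\<close>

lemma shifted_powr_supporting_line:
  fixes p c e D s :: real
  assumes p: "1 < p" and "0 < D" "0 \<le> e" "0 \<le> e + (p - 2) * c"
  defines "\<psi> \<equiv> \<lambda>s. (c * D + e * s) * (2 * s + D) powr (p - 1)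
    - (c * D + (2 * c - e) * s) * D powr (p - 1)"
  shows "\<exists>m. \<forall>u. \<psi> (max s 0) + m * (u - s) \<le> \<psi> (max u 0)"
proof -
  define \<psi>' where "\<psi>' = (\<lambda>s. e * (2 * s + D) powr (p - 1)
    + 2 * (p - 1) * (c * D + e * s) * (2 * s + D) powr (p - 2) - (2 * c - e) * D powr (p - 1))"
  define \<psi>'' where "\<psi>'' = (\<lambda>s. 4 * (p - 1) * e * (2 * s + D) powr (p - 2)
    + 4 * (p - 1) * (p - 2) * (c * D + e * s) * (2 * s + D) powr (p - 3))"
  have d1: "(\<psi> has_real_derivative \<psi>' x) (at x)" if "0 \<le> x" for x
    unfolding \<psi>_def \<psi>'_def using that \<open>0 < D\<close>
    by (auto intro!: derivative_eq_intros simp: algebra_simps)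
  have d2: "(\<psi>' has_real_derivative \<psi>'' x) (at x)" if "0 \<le> x" for x
    unfolding \<psi>'_def \<psi>''_def using that \<open>0 < D\<close>
    by (auto intro!: derivative_eq_intros simp: algebra_simps)
  have pos: "0 \<le> \<psi>'' x" if "0 \<le> x" for x
  proof -
    have "(2 * x + D) powr (p - 2) = (2 * x + D) * (2 * x + D) powr (p - 3)"
      using that \<open>0 < D\<close> powr_mult_base[of "2 * x + D" "p - 3"] by simp
    then have "\<psi>'' x = 4 * (p - 1) * (2 * x + D) powr (p - 3) *
        (D * (e + (p - 2) * c) + p * (e * x))"
      unfolding \<psi>''_def by (simp add: algebra_simps)
    moreover have "0 \<le> D * (e + (p - 2) * c) + p * (e * x)" using assms that by simp
    then have "0 \<le> 4 * (p - 1) * (2 * x + D) powr (p - 3) *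
        (D * (e + (p - 2) * c) + p * (e * x))"
      by (rule mult_nonneg_nonneg[rotated]) (use p in simp)
    ultimately show ?thesis by simp
  qed
  have tangent: "\<psi>' x * (y - x) \<le> \<psi> y - \<psi> x" if "0 \<le> x" "0 \<le> y" for x y
    using that by (intro f''_imp_f'[where C = "{0..}" and f'' = \<psi>'']) (auto intro: d1 d2 pos)
  have "D powr (p - 1) = D * D powr (p - 2)"
    using \<open>0 < D\<close> powr_mult_base[of D "p - 2"] by simp
  then have "\<psi>' 0 = D powr (p - 1) * (2 * (e + (p - 2) * c))"
    unfolding \<psi>'_def by (simp add: algebra_simps)
  then have zero: "0 \<le> \<psi>' 0" using assms by simp
  show ?thesis
  proof (cases "0 < s")
    case True
    \<comment> \<open>Comparing the tangents at 0 and at \<open>s\<close> shows that the slope at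
      \<open>s\<close> is nonnegative too. This is what allows \<open>max u 0\<close> to be replaced
      by the smaller \<open>u\<close> in the linear term.\<close>
    have "\<psi>' 0 * s \<le> \<psi> s - \<psi> 0" "\<psi> s - \<psi> 0 \<le> \<psi>' s * s"
      using tangent[of 0 s] tangent[of s 0] True by auto
    then have "\<psi>' 0 * s \<le> \<psi>' s * s" by linarith
    then have nonneg: "0 \<le> \<psi>' s" using True zero by simp
    have "\<psi> (max s 0) + \<psi>' s * (u - s) \<le> \<psi> (max u 0)" for u
    proof -
      have "\<psi>' s * (u - s) \<le> \<psi>' s * (max u 0 - s)"
        using nonneg by (intro mult_left_mono) auto
      also have "\<dots> \<le> \<psi> (max u 0) - \<psi> s" using tangent[of s "max u 0"] True by simp
      finally show ?thesis using True by simp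
    qed
    then show ?thesis by blast
  next
    case False
    have "\<psi> 0 \<le> \<psi> (max u 0)" for u
    proof -
      have "0 \<le> \<psi>' 0 * (max u 0 - 0)" using zero by (intro mult_nonneg_nonneg) auto
      then show ?thesis using tangent[of 0 "max u 0"] by simp
    qed
    then show ?thesis using False by (intro exI[of _ 0]) (simp add: max_def)
  qed
qed

text \<open>Burkholder's function, up to a constant factor: \<open>a = 1\<close>, \<open>b = p - 1\<close> for \<open>p \<ge> 2\<close>
  and \<open>a = p - 1\<close>, \<open>b = 1\<close> for \<open>p \<le> 2\<close>.\<close>

definition burkholder :: "real \<Rightarrow> real \<Rightarrow> real \<Rightarrow> real \<Rightarrow> real \<Rightarrow> real" where
  "burkholder p a b x y = (a * \<bar>y\<bar> - b * \<bar>x\<bar>) * (\<bar>x\<bar> + \<bar>y\<bar>) powr (p - 1)"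

lemma burkholder_uminus [simp]:
  "burkholder p a b (- x) y = burkholder p a b x y"
  "burkholder p a b x (- y) = burkholder p a b x y"
  by (simp_all add: burkholder_def)

text \<open>On the line \<open>y = x + D\<close> the function is a linear function minus two convex corrections, one for
  each axis that the line crosses.\<close>

lemma burkholder_supporting_line:
  fixes p a b D s :: real
  assumes p: "1 < p" and ab: "0 \<le> a" "a \<le> b" "(p - 1) * a \<le> b" "a \<le> (p - 1) * b" and "0 \<le> D"
  shows "\<exists>m. \<forall>u. burkholder p a b u (u + D) \<le> burkholder p a b s (s + D) + m * (u - s)"
proof (cases "D = 0")
  case True
  obtain m where m: "\<And>y. \<bar>s\<bar> powr p + m * (y - s) \<le> \<bar>y\<bar> powr p"
    using abs_powr_supporting_line[OF p, of s] by blast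
  \<comment> \<open>For \<open>D = 0\<close> the line crosses both axes at the origin, and the
    function is a nonpositive multiple of \<open>\<bar>u\<bar> powr p\<close>.\<close>
  have eq: "burkholder p a b u u = - ((b - a) * 2 powr (p - 1)) * \<bar>u\<bar> powr p" for u
  proof -
    have "\<bar>u\<bar> * \<bar>u\<bar> powr (p - 1) = \<bar>u\<bar> powr p"
      using powr_mult_base[of "\<bar>u\<bar>" "p - 1"] by simp
    moreover have "burkholder p a b u u = (a - b) * 2 powr (p - 1) * (\<bar>u\<bar> * \<bar>u\<bar> powr (p - 1))"
      by (simp add: burkholder_def algebra_simps powr_mult flip: mult_2)
    ultimately show ?thesis by (simp add: algebra_simps)
  qed
  have "burkholder p a b u u \<le> burkholder p a b s s + - ((b - a) * 2 powr (p - 1)) * m * (u - s)" for u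
  proof -
    have "(b - a) * 2 powr (p - 1) * (\<bar>s\<bar> powr p + m * (u - s)) \<le> (b - a) * 2 powr (p - 1) * \<bar>u\<bar> powr p"
      using m[of u] ab by (intro mult_left_mono) auto
    then show ?thesis unfolding eq by (simp add: algebra_simps)
  qed
  then show ?thesis
    unfolding True add_0_right by (intro exI allI)
next
  case False
  then have "0 < D" using \<open>0 \<le> D\<close> by simp
  define \<psi> where "\<psi> = (\<lambda>c s. (c * D + (b - a) * s) * (2 * s + D) powr (p - 1)
    - (c * D + (2 * c - (b - a)) * s) * D powr (p - 1))"
  \<comment> \<open>The linear part is the formula valid between the axes, for
    \<open>- D \<le> u \<le> 0\<close>, where both corrections vanish.\<close>
  have eq: "burkholder p a b u (u + D) = (a * D + (a + b) * u) * D powr (p - 1)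
      - \<psi> (- a) (max u 0) - \<psi> b (max (- D - u) 0)" for u
  proof -
    consider "0 \<le> u" | "- D \<le> u" "u \<le> 0" | "u \<le> - D" by linarith
    then show ?thesis
    proof cases
      case 1
      then have "\<bar>u\<bar> = u" "\<bar>u + D\<bar> = u + D" "max u 0 = u" "max (- D - u) 0 = 0" "u + (u + D) = 2 * u + D"
        using \<open>0 < D\<close> by auto
      then show ?thesis by (simp add: burkholder_def \<psi>_def algebra_simps)
    next
      case 2
      then have "\<bar>u\<bar> = - u" "\<bar>u + D\<bar> = u + D" "max u 0 = 0" "max (- D - u) 0 = 0" by auto
      then show ?thesis by (simp add: burkholder_def \<psi>_def algebra_simps)
    next
      case 3
      define v where "v = - D - u"
      have u: "u = - D - v" and "0 \<le> v" using 3 by (auto simp: v_def)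
      then have "\<bar>u\<bar> = D + v" "\<bar>u + D\<bar> = v" "max u 0 = 0" "max (- D - u) 0 = v"
        "D + v + v = 2 * v + D"
        using \<open>0 < D\<close> by auto
      then show ?thesis by (simp add: burkholder_def \<psi>_def u algebra_simps)
    qed
  qed
  \<comment> \<open>The condition \<open>0 \<le> e + (p - 2) * c\<close> becomes
    \<open>(p - 1) * a \<le> b\<close> for \<open>c = - a\<close>, and
    \<open>a \<le> (p - 1) * b\<close> for \<open>c = b\<close>.\<close>
  obtain m\<^sub>1 where m1: "\<And>u. \<psi> (- a) (max s 0) + m\<^sub>1 * (u - s) \<le> \<psi> (- a) (max u 0)"
    using shifted_powr_supporting_line[of p D "b - a" "- a" s] p ab \<open>0 < D\<close>
    by (auto simp: \<psi>_def algebra_simps)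
  obtain m\<^sub>2 where m2: "\<And>u. \<psi> b (max (- D - s) 0) + m\<^sub>2 * (u - (- D - s)) \<le> \<psi> b (max u 0)"
    using shifted_powr_supporting_line[of p D "b - a" b "- D - s"] p ab \<open>0 < D\<close>
    by (auto simp: \<psi>_def algebra_simps)
  have "burkholder p a b u (u + D) \<le> burkholder p a b s (s + D)
      + ((a + b) * D powr (p - 1) - m\<^sub>1 + m\<^sub>2) * (u - s)" for u
    using m1[of u] m2[of "- D - u"] unfolding eq by (simp add: algebra_simps)
  then show ?thesis by blast
qed

text \<open>The supporting line at the midpoint bounds both end values, and its slope cancels in the
  sum. Changing both signs reduces to \<open>x \<le> y\<close>; changing the sign of
  \<open>y\<close> alone exchanges the two diagonal directions.\<close>

lemma burkholder_midpoint:
  fixes p a b x y h :: real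
  assumes p: "1 < p" and ab: "0 \<le> a" "a \<le> b" "(p - 1) * a \<le> b" "a \<le> (p - 1) * b"
  shows "burkholder p a b (x + h) (y + h) + burkholder p a b (x - h) (y - h) \<le> 2 * burkholder p a b x y"
    and "burkholder p a b (x + h) (y - h) + burkholder p a b (x - h) (y + h) \<le> 2 * burkholder p a b x y"
proof -
  have le: "burkholder p a b (x + h) (y + h) + burkholder p a b (x - h) (y - h) \<le> 2 * burkholder p a b x y"
    if xy: "x \<le> y" for x y h
  proof -
    obtain m where m: "\<And>u. burkholder p a b u (u + (y - x)) \<le> burkholder p a b x (x + (y - x)) + m * (u - x)"
      using burkholder_supporting_line[OF assms, of "y - x" x] xy by auto
    show ?thesis using m[of "x + h"] m[of "x - h"] by (simp add: algebra_simps)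
  qed
  show *: "burkholder p a b (x + h) (y + h) + burkholder p a b (x - h) (y - h) \<le> 2 * burkholder p a b x y"
    for x y h
  proof (cases "x \<le> y")
    case True
    then show ?thesis by (rule le)
  next
    case False
    have neg: "burkholder p a b u v = burkholder p a b (- u) (- v)" for u v by simp
    show ?thesis using le[of "- x" "- y" "- h"] False
      by (subst (1 2 3) neg) (simp add: algebra_simps)
  qed
  have "- y + h = - (y - h)" "- y - h = - (y + h)" by simp_all
  then show "burkholder p a b (x + h) (y - h) + burkholder p a b (x - h) (y + h) \<le> 2 * burkholder p a b x y"
    using *[of x h "- y"] by (simp only: burkholder_uminus)
qed

text \<open>Both sides are homogeneous of degree \<open>p\<close> and vanish on the ray
  \<open>y = (p - 1) * x\<close>. Dividing by \<open>x + y\<close> leaves the single parameter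
  \<open>d\<close>, and \<open>\<alpha>\<close> is the factor for which the two sides have the same
  derivative at \<open>d = 0\<close>.\<close>

lemma burkholder_majorant_aux:
  fixes p x y :: real
  assumes p: "1 < p" and "0 \<le> x" "0 \<le> y"
  defines "\<alpha> \<equiv> p * ((p - 1) / p) powr (p - 1)"
  shows "2 \<le> p \<Longrightarrow> y powr p - ((p - 1) * x) powr p \<le> \<alpha> * (y - (p - 1) * x) * (x + y) powr (p - 1)"
    and "p \<le> 2 \<Longrightarrow> \<alpha> * (y - (p - 1) * x) * (x + y) powr (p - 1) \<le> y powr p - ((p - 1) * x) powr p"
proof -
  define S where "S = x + y"
  \<comment> \<open>With this \<open>d\<close>, \<open>y\<close> and \<open>(p - 1) * x\<close>
    become the common factor \<open>S * (p - 1) / p\<close> times \<open>1 + d / (p - 1)\<close> and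
    \<open>1 - d\<close>.\<close>
  define d where "d = (y - (p - 1) * x) / S"
  define B where "B = (S * (p - 1) / p) powr p"
  have "0 < p" using p by simp
  have goal: "y powr p - ((p - 1) * x) powr p - \<alpha> * (y - (p - 1) * x) * (x + y) powr (p - 1)
      = B * ((1 + d / (p - 1)) powr p - (1 - d) powr p - p\<^sup>2 / (p - 1) * d)" if "S \<noteq> 0"
  proof -
    have "0 < S" using that assms by (simp add: S_def)
    have dS: "y - (p - 1) * x = d * S" using that by (simp add: d_def)
    have x: "(p - 1) * x = S * (p - 1) / p * (1 - d)"
    proof -
      have "p * x = S - d * S" unfolding dS[symmetric] by (simp add: S_def algebra_simps)
      then have px: "p * x = S * (1 - d)" by (simp add: algebra_simps)
      have "(p - 1) * x = (p - 1) / p * (p * x)" using p by simp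
      then show ?thesis unfolding px by simp
    qed
    have y: "y = S * (p - 1) / p * (1 + d / (p - 1))"
    proof -
      have "p * y = S * (p - 1) + d * S" unfolding dS[symmetric] by (simp add: S_def algebra_simps)
      also have "\<dots> = S * (p - 1 + d)" by (simp add: algebra_simps)
      also have "p - 1 + d = (p - 1) * (1 + d / (p - 1))" using p by (simp add: distrib_left)
      finally have py: "p * y = S * ((p - 1) * (1 + d / (p - 1)))" .
      have "y = p * y / p" using p by simp
      then show ?thesis unfolding py by simp
    qed
    have b0: "0 \<le> S * (p - 1) / p" using \<open>0 < S\<close> p by simp
    have "0 \<le> 1 - d" using x assms(2) p \<open>0 < S\<close>
      by (smt (verit) divide_pos_pos mult_nonneg_nonneg mult_pos_neg mult_pos_pos)
    have "0 \<le> 1 + d / (p - 1)" using y assms(3) p \<open>0 < S\<close>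
      by (smt (verit) divide_pos_pos mult_pos_neg mult_pos_pos)
    have yp: "y powr p = B * (1 + d / (p - 1)) powr p"
      by (subst y) (use b0 \<open>0 \<le> 1 + d / (p - 1)\<close> in \<open>simp only: powr_mult B_def\<close>)
    have xp: "((p - 1) * x) powr p = B * (1 - d) powr p"
      by (subst x) (use b0 \<open>0 \<le> 1 - d\<close> in \<open>simp only: powr_mult B_def\<close>)
    have "\<alpha> * (d * S) * S powr (p - 1) = p * d * (((p - 1) / p) powr (p - 1) * (S * S powr (p - 1)))"
      by (simp add: \<alpha>_def)
    also have "S * S powr (p - 1) = S powr p" using powr_mult_base[of S "p - 1"] \<open>0 < S\<close> by simp
    also have "((p - 1) / p) powr (p - 1) = ((p - 1) / p) powr p * (p / (p - 1))"
      using p by (simp add: powr_diff)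
    also have "p * d * (((p - 1) / p) powr p * (p / (p - 1)) * S powr p) = B * (p\<^sup>2 / (p - 1) * d)"
    proof -
      have "S * (p - 1) / p = (p - 1) / p * S" by simp
      then have "B = ((p - 1) / p) powr p * S powr p"
        unfolding B_def using p \<open>0 < S\<close> by (simp only: powr_mult)
      then show ?thesis by (simp add: power2_eq_square)
    qed
    finally have "\<alpha> * (y - (p - 1) * x) * (x + y) powr (p - 1) = B * (p\<^sup>2 / (p - 1) * d)"
      by (simp add: dS flip: S_def)
    then show ?thesis unfolding yp xp by (simp add: algebra_simps)
  qed
  have d: "- (p - 1) \<le> d" "d \<le> 1" if "S \<noteq> 0"
  proof -
    have "0 < S" using that assms by (simp add: S_def)
    moreover have "0 \<le> p * x" "0 \<le> p * y" using assms by auto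
    ultimately show "- (p - 1) \<le> d" "d \<le> 1"
      by (auto simp: d_def le_divide_eq divide_le_eq S_def algebra_simps)
  qed
  have "0 \<le> B" by (simp add: B_def)
  have zero: "x = 0" "y = 0" if "S = 0" using that assms by (auto simp: S_def)
  show "y powr p - ((p - 1) * x) powr p \<le> \<alpha> * (y - (p - 1) * x) * (x + y) powr (p - 1)" if "2 \<le> p"
  proof (cases "S = 0")
    case False
    then show ?thesis
      using goal mult_nonneg_nonpos[OF \<open>0 \<le> B\<close> powr_difference_tangent(1)[OF p d that]] by simp
  qed (use zero in simp)
  show "\<alpha> * (y - (p - 1) * x) * (x + y) powr (p - 1) \<le> y powr p - ((p - 1) * x) powr p" if "p \<le> 2"
  proof (cases "S = 0")
    case False
    then show ?thesis
      using goal mult_nonneg_nonneg[OF \<open>0 \<le> B\<close> powr_difference_tangent(2)[OF p d that]] by simp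
  qed (use zero in simp)
qed

text \<open>The properties of Burkholder's function that the induction over dyadic levels needs, for
  all \<open>p\<close> at once. Nonpositivity on the diagonals comes from
  \<open>a \<le> b\<close>.\<close>

lemma zigzag_concave_majorant:
  fixes p :: real
  assumes p: "1 < p"
  obtains W :: "real \<Rightarrow> real \<Rightarrow> real" where
    "\<And>x y h. W (x + h) (y + h) + W (x - h) (y - h) \<le> 2 * W x y"
    "\<And>x y h. W (x + h) (y - h) + W (x - h) (y + h) \<le> 2 * W x y"
    "\<And>x. W x x \<le> 0" "\<And>x. W x (- x) \<le> 0"
    "\<And>x y. \<bar>y\<bar> powr p - (max p (p / (p - 1)) - 1) powr p * \<bar>x\<bar> powr p \<le> W x y"
proof -
  note majorantI = that
  define \<alpha> where "\<alpha> = p * ((p - 1) / p) powr (p - 1)"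
  have "0 < \<alpha>" using p by (simp add: \<alpha>_def)
  have *: thesis if ab: "0 \<le> a" "a \<le> b" "(p - 1) * a \<le> b" "a \<le> (p - 1) * b" and "0 < k"
    and major: "\<And>x y. \<bar>y\<bar> powr p - (max p (p / (p - 1)) - 1) powr p * \<bar>x\<bar> powr p \<le> k * burkholder p a b x y"
    for a b k
  proof (rule majorantI[of "\<lambda>x y. k * burkholder p a b x y"])
    fix x y h
    show "k * burkholder p a b (x + h) (y + h) + k * burkholder p a b (x - h) (y - h) \<le> 2 * (k * burkholder p a b x y)"
      using mult_left_mono[OF burkholder_midpoint(1)[OF p ab, of x h y], of k] \<open>0 < k\<close>
      by (simp add: algebra_simps)
    show "k * burkholder p a b (x + h) (y - h) + k * burkholder p a b (x - h) (y + h) \<le> 2 * (k * burkholder p a b x y)"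
      using mult_left_mono[OF burkholder_midpoint(2)[OF p ab, of x h y], of k] \<open>0 < k\<close>
      by (simp add: algebra_simps)
  next
    fix x
    have "(a - b) * \<bar>x\<bar> * (2 * \<bar>x\<bar>) powr (p - 1) \<le> 0"
      using ab by (intro mult_nonpos_nonneg) auto
    then show "k * burkholder p a b x x \<le> 0" "k * burkholder p a b x (- x) \<le> 0"
      using \<open>0 < k\<close> by (auto simp: burkholder_def mult_le_0_iff algebra_simps)
  qed (rule major)
  show ?thesis
  proof (cases "2 \<le> p")
    case True
    have C: "max p (p / (p - 1)) - 1 = p - 1"
    proof -
      have "p * 1 \<le> p * (p - 1)" using True by (intro mult_left_mono) auto
      then show ?thesis using p by (simp add: max_def field_simps)
    qed
    show ?thesis
    proof (rule *[where a = 1 and b = "p - 1" and k = \<alpha>])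
      have "1 * 1 \<le> (p - 1) * (p - 1)" using True by (intro mult_mono) auto
      then show "1 \<le> (p - 1) * (p - 1)" by simp
      show "\<bar>y\<bar> powr p - (max p (p / (p - 1)) - 1) powr p * \<bar>x\<bar> powr p \<le> \<alpha> * burkholder p 1 (p - 1) x y" for x y
        using burkholder_majorant_aux(1)[OF p, of "\<bar>x\<bar>" "\<bar>y\<bar>"] True
        unfolding C by (simp add: burkholder_def \<alpha>_def powr_mult mult.assoc)
    qed (use True \<open>0 < \<alpha>\<close> in auto)
  next
    case False
    have C: "max p (p / (p - 1)) - 1 = 1 / (p - 1)"
    proof -
      have "p * (p - 1) \<le> p * 1" using False p by (intro mult_left_mono) auto
      then show ?thesis using p by (simp add: max_def field_simps)
    qed
    show ?thesis
    \<comment> \<open>For \<open>p < 2\<close> the comparison is reversed, so it is applied with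
      \<open>x\<close> and \<open>y\<close> exchanged. The factor
      \<open>(1 / (p - 1)) powr p\<close> normalises the coefficient of
      \<open>\<bar>y\<bar> powr p\<close> to 1 and produces the constant
      \<open>1 / (p - 1)\<close>.\<close>
    proof (rule *[where a = "p - 1" and b = 1 and k = "\<alpha> * (1 / (p - 1)) powr p"])
      have "(p - 1) * (p - 1) \<le> 1 * 1" using False p by (intro mult_mono) auto
      then show "(p - 1) * (p - 1) \<le> 1" by simp
      fix x y :: real
      have "\<alpha> * (\<bar>x\<bar> - (p - 1) * \<bar>y\<bar>) * (\<bar>x\<bar> + \<bar>y\<bar>) powr (p - 1) \<le> \<bar>x\<bar> powr p - (p - 1) powr p * \<bar>y\<bar> powr p"
        using burkholder_majorant_aux(2)[OF p, of "\<bar>y\<bar>" "\<bar>x\<bar>"] False p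
        by (simp add: \<alpha>_def powr_mult add.commute)
      then have "(1 / (p - 1)) powr p * ((p - 1) powr p * \<bar>y\<bar> powr p - \<bar>x\<bar> powr p)
          \<le> (1 / (p - 1)) powr p * (\<alpha> * burkholder p (p - 1) 1 x y)"
        by (intro mult_left_mono) (auto simp: burkholder_def algebra_simps)
      moreover have "(1 / (p - 1)) powr p * (p - 1) powr p = 1"
        using p by (simp flip: powr_mult)
      ultimately show "\<bar>y\<bar> powr p - (max p (p / (p - 1)) - 1) powr p * \<bar>x\<bar> powr p
          \<le> \<alpha> * (1 / (p - 1)) powr p * burkholder p (p - 1) 1 x y"
        unfolding C by (simp add: right_diff_distrib mult.assoc[symmetric]) (simp add: mult_ac)
    qed (use False p \<open>0 < \<alpha>\<close> in auto)
  qed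
qed

section \<open>Haar sums on dyadic cells\<close>

text \<open>\<open>dyadic_value c n k\<close> is the value on $[k2^{-n}, (k+1)2^{-n})$ of the partial Haar sum with
  coefficients \<open>c\<close> over the indices in \<open>haar_indices n\<close>.\<close>

primrec dyadic_value :: "(haar_index \<Rightarrow> real) \<Rightarrow> nat \<Rightarrow> nat \<Rightarrow> real" where
  "dyadic_value c 0 k = c Whole"
| "dyadic_value c (Suc n) k = dyadic_value c n (k div 2) +
     (if even k then 1 else - 1) * 2 powr (real n / 2) * c (Dyadic n (Suc (k div 2)))"

text \<open>Cells are numbered from 0, whereas the second argument of \<open>Dyadic\<close> starts
  at 1. This accounts for the shifts by \<open>Suc\<close> and \<open>j - 1\<close> below.\<close>

definition dyadic_cell :: "nat \<Rightarrow> nat \<Rightarrow> real set" where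
  "dyadic_cell n k = {real k / 2 ^ n ..< real (Suc k) / 2 ^ n}"

text \<open>These are the \<open>2 ^ N\<close> Haar functions that are constant on every cell of
  level \<open>N\<close>.\<close>

definition haar_indices :: "nat \<Rightarrow> haar_index set" where
  "haar_indices N = insert Whole {Dyadic n j | n j. n < N \<and> 1 \<le> j \<and> j \<le> 2 ^ n}"

lemma sum_lessThan_double:
  fixes f :: "nat \<Rightarrow> 'a::comm_monoid_add"
  shows "(\<Sum>k<2 * n. f k) = (\<Sum>k<n. f (2 * k) + f (Suc (2 * k)))"
  by (induction n) (auto simp: ac_simps)

text \<open>Burkholder's argument. From a cell to its two halves, the pair of values of the original
  and the sign-changed sum moves by opposite steps along one diagonal direction. Hence the average
  of \<open>W\<close> over the cells does not increase with the level. At level 0 the pair lies on a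
  diagonal, where \<open>W \<le> 0\<close>.\<close>

lemma sum_dyadic_value_sign_le:
  fixes p :: real and \<epsilon> c :: "haar_index \<Rightarrow> real"
  assumes p: "1 < p" and \<epsilon>: "\<And>I. \<epsilon> I = 1 \<or> \<epsilon> I = - 1"
  shows "(\<Sum>k<2 ^ N. \<bar>dyadic_value (\<lambda>I. \<epsilon> I * c I) N k\<bar> powr p)
    \<le> (max p (p / (p - 1)) - 1) powr p * (\<Sum>k<2 ^ N. \<bar>dyadic_value c N k\<bar> powr p)"
proof -
  obtain W :: "real \<Rightarrow> real \<Rightarrow> real" where
    W: "\<And>x y h. W (x + h) (y + h) + W (x - h) (y - h) \<le> 2 * W x y"
      "\<And>x y h. W (x + h) (y - h) + W (x - h) (y + h) \<le> 2 * W x y"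
      "\<And>x. W x x \<le> 0" "\<And>x. W x (- x) \<le> 0"
      "\<And>x y. \<bar>y\<bar> powr p - (max p (p / (p - 1)) - 1) powr p * \<bar>x\<bar> powr p \<le> W x y"
    by (rule zigzag_concave_majorant[OF p], rule that)
  define f where "f = dyadic_value c"
  define g where "g = dyadic_value (\<lambda>I. \<epsilon> I * c I)"
  have "(\<Sum>k<2 ^ N. W (f N k) (g N k)) \<le> 0"
  proof (induction N)
    case 0
    show ?case using \<epsilon>[of Whole] W(3,4) by (auto simp: f_def g_def)
  next
    case (Suc N)
    have "W (f (Suc N) (2 * k)) (g (Suc N) (2 * k)) + W (f (Suc N) (Suc (2 * k))) (g (Suc N) (Suc (2 * k)))
        \<le> 2 * W (f N k) (g N k)" for k
      using \<epsilon>[of "Dyadic N (Suc k)"] W(1,2)[of "f N k" "2 powr (real N / 2) * c (Dyadic N (Suc k))" "g N k"]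
      by (auto simp: f_def g_def)
    then have "(\<Sum>k<2 ^ Suc N. W (f (Suc N) k) (g (Suc N) k)) \<le> (\<Sum>k<2 ^ N. 2 * W (f N k) (g N k))"
      unfolding power_Suc sum_lessThan_double by (intro sum_mono)
    also have "\<dots> \<le> 0" using Suc.IH by (simp flip: sum_distrib_left)
    finally show ?case .
  qed
  moreover have "(\<Sum>k<2 ^ N. \<bar>g N k\<bar> powr p - (max p (p / (p - 1)) - 1) powr p * \<bar>f N k\<bar> powr p)
      \<le> (\<Sum>k<2 ^ N. W (f N k) (g N k))"
    by (intro sum_mono W)
  ultimately show ?thesis
    by (simp add: sum_subtractf f_def g_def flip: sum_distrib_left)
qed

section \<open>Geometry of dyadic cells and values of Haar functions on them\<close>

lemma dyadic_cell_iff: "x \<in> dyadic_cell n k \<longleftrightarrow> real k \<le> x * 2 ^ n \<and> x * 2 ^ n < real (Suc k)"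
  by (simp add: dyadic_cell_def field_simps)

lemma dyadic_cell_unique: "x \<in> dyadic_cell n k \<Longrightarrow> x \<in> dyadic_cell n j \<Longrightarrow> j = k"
  unfolding dyadic_cell_iff by linarith

lemma indicator_dyadic_cell:
  "x \<in> dyadic_cell n k \<Longrightarrow> indicator (dyadic_cell n j) x = (if j = k then 1 else 0)"
  using dyadic_cell_unique by (auto simp: indicator_def)

lemma ex_dyadic_cell:
  assumes "0 \<le> x" "x < 1"
  shows "\<exists>k<2 ^ n. x \<in> dyadic_cell n k"
proof (intro exI conjI)
  have "x * 2 ^ n < 1 * 2 ^ n" using assms by (intro mult_strict_right_mono) auto
  then show "nat \<lfloor>x * 2 ^ n\<rfloor> < 2 ^ n" using assms by (simp add: nat_less_iff floor_less_iff)
  show "x \<in> dyadic_cell n (nat \<lfloor>x * 2 ^ n\<rfloor>)"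
    unfolding dyadic_cell_iff using assms by (simp add: of_nat_nat) linarith
qed

lemma dyadic_cell_subset: "k < 2 ^ n \<Longrightarrow> dyadic_cell n k \<subseteq> {0..<1}"
proof
  fix x assume k: "k < 2 ^ n" and x: "x \<in> dyadic_cell n k"
  have "real (Suc k) \<le> real (2 ^ n)" using k by (simp only: of_nat_le_iff Suc_le_eq)
  moreover have "0 \<le> real k" by simp
  ultimately have "0 \<le> x * 2 ^ n" "x * 2 ^ n < 1 * 2 ^ n"
    using x unfolding dyadic_cell_iff of_nat_power of_nat_numeral by linarith+
  then have "0 \<le> x * 2 ^ n" "x < 1" by auto
  moreover have "(0::real) < 2 ^ n" by simp
  ultimately show "x \<in> {0..<1}" by (auto simp: zero_le_mult_iff)
qed

lemma dyadic_cell_Suc: "x \<in> dyadic_cell (Suc n) k \<Longrightarrow> x \<in> dyadic_cell n (k div 2)"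
proof -
  assume *: "x \<in> dyadic_cell (Suc n) k"
  have "2 * (k div 2) \<le> k" "Suc k \<le> 2 * Suc (k div 2)" by auto
  then have "real (2 * (k div 2)) \<le> real k" "real (Suc k) \<le> real (2 * Suc (k div 2))"
    by (auto simp only: of_nat_le_iff)
  then show ?thesis using * unfolding dyadic_cell_iff by simp
qed

lemma indicator_dyadic_cell_split:
  "indicator (dyadic_cell n k) x =
    (indicator (dyadic_cell (Suc n) (2 * k)) x + indicator (dyadic_cell (Suc n) (Suc (2 * k))) x :: real)"
proof (cases "x \<in> dyadic_cell n k")
  case True
  then have "x \<in> dyadic_cell (Suc n) (2 * k) \<and> x \<notin> dyadic_cell (Suc n) (Suc (2 * k)) \<or>
    x \<notin> dyadic_cell (Suc n) (2 * k) \<and> x \<in> dyadic_cell (Suc n) (Suc (2 * k))"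
    unfolding dyadic_cell_iff by (auto simp: not_le not_less)
  then show ?thesis using True by auto
next
  case False
  then show ?thesis
    using dyadic_cell_Suc[of x n "2 * k"] dyadic_cell_Suc[of x n "Suc (2 * k)"] by (auto simp: indicator_def)
qed

lemma haar_Dyadic_Suc:
  "haar (Dyadic n (Suc k)) x = 2 powr (real n / 2) *
    (indicator (dyadic_cell (Suc n) (2 * k)) x - indicator (dyadic_cell (Suc n) (Suc (2 * k))) x)"
proof -
  have "{(real (Suc k) - 1) / 2 ^ n ..< (real (Suc k) - 1 / 2) / 2 ^ n} = dyadic_cell (Suc n) (2 * k)"
    "{(real (Suc k) - 1 / 2) / 2 ^ n ..< real (Suc k) / 2 ^ n} = dyadic_cell (Suc n) (Suc (2 * k))"
    unfolding dyadic_cell_def by (auto simp: field_simps)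
  moreover have "x \<in> dyadic_cell (Suc n) (2 * k) \<Longrightarrow> x \<notin> dyadic_cell (Suc n) (Suc (2 * k))"
    using dyadic_cell_unique[of x "Suc n" "2 * k" "Suc (2 * k)"] by auto
  ultimately show ?thesis unfolding haar.simps by (auto simp: indicator_def)
qed

lemma haar_Whole_eq: "haar Whole = indicator (dyadic_cell 0 0)"
  by (auto simp: fun_eq_iff dyadic_cell_def indicator_def)

declare haar.simps [simp del]

lemma finite_haar_indices [simp]: "finite (haar_indices N)"
proof -
  have "haar_indices N \<subseteq> insert Whole ((\<lambda>(n, j). Dyadic n j) ` (SIGMA n:{..<N}. {..2 ^ n}))"
    by (auto simp: haar_indices_def)
  then show ?thesis by (rule finite_subset) auto
qed

lemma finite_subset_haar_indices:
  assumes "finite Q" "Q \<subseteq> dyadic_intervals"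
  shows "\<exists>N. Q \<subseteq> haar_indices N"
  using assms
proof (induction Q)
  case (insert I Q)
  then obtain N where N: "Q \<subseteq> haar_indices N" by auto
  have mono: "haar_indices N \<subseteq> haar_indices M" if "N \<le> M" for N M
    using that by (force simp: haar_indices_def)
  obtain M where "I \<in> haar_indices M"
    using insert.prems by (auto simp: dyadic_intervals_def haar_indices_def)
  then show ?case using N mono[of N "max N M"] mono[of M "max N M"] by (intro exI[of _ "max N M"]) auto
qed auto

lemma haar_indices_0: "haar_indices 0 = {Whole}"
  by (simp add: haar_indices_def)

lemma sum_haar_indices_Suc:
  fixes f :: "haar_index \<Rightarrow> 'a::comm_monoid_add"
  shows "(\<Sum>I\<in>haar_indices (Suc N). f I) = (\<Sum>I\<in>haar_indices N. f I) + (\<Sum>k<2 ^ N. f (Dyadic N (Suc k)))"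
proof -
  have "haar_indices (Suc N) = haar_indices N \<union> (\<lambda>k. Dyadic N (Suc k)) ` {..<2 ^ N}"
  proof -
    have "Dyadic N j \<in> (\<lambda>k. Dyadic N (Suc k)) ` {..<2 ^ N}" if "1 \<le> j" "j \<le> 2 ^ N" for j
      using that by (intro image_eqI[of _ _ "j - 1"]) auto
    moreover have "(\<lambda>k. Dyadic N (Suc k)) ` {..<2 ^ N} \<subseteq> haar_indices (Suc N)"
      "haar_indices N \<subseteq> haar_indices (Suc N)"
      by (auto simp: haar_indices_def Suc_le_eq)
    moreover have "haar_indices (Suc N) \<subseteq> haar_indices N \<union> Dyadic N ` {1..2 ^ N}"
      by (auto simp: haar_indices_def less_Suc_eq)
    ultimately show ?thesis by auto
  qed
  moreover have "haar_indices N \<inter> (\<lambda>k. Dyadic N (Suc k)) ` {..<2 ^ N} = {}"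
    by (auto simp: haar_indices_def)
  moreover have "(\<Sum>I\<in>(\<lambda>k. Dyadic N (Suc k)) ` {..<2 ^ N}. f I) = (\<Sum>k<2 ^ N. f (Dyadic N (Suc k)))"
    by (subst sum.reindex) (auto simp: inj_on_def)
  ultimately show ?thesis by (simp add: sum.union_disjoint)
qed

lemma haar_Dyadic_on_cell:
  assumes "x \<in> dyadic_cell (Suc n) k"
  shows "haar (Dyadic n (Suc j)) x =
    (if j = k div 2 then (if even k then 1 else - 1) * 2 powr (real n / 2) else 0)"
proof -
  have "j = k div 2 \<longleftrightarrow> k = 2 * j \<or> k = Suc (2 * j)" by auto
  then show ?thesis
    unfolding haar_Dyadic_Suc indicator_dyadic_cell[OF assms] by auto
qed

lemma haar_sum_on_cell:
  assumes "x \<in> dyadic_cell N k" "k < 2 ^ N"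
  shows "(\<Sum>I\<in>haar_indices N. c I * haar I x) = dyadic_value c N k"
  using assms
proof (induction N arbitrary: k)
  case 0
  then show ?case by (simp add: haar_indices_0 haar_Whole_eq)
next
  case (Suc N)
  have k: "k div 2 < 2 ^ N" using Suc.prems by auto
  have "(\<Sum>j<2 ^ N. c (Dyadic N (Suc j)) * haar (Dyadic N (Suc j)) x) =
      (\<Sum>j<2 ^ N. if j = k div 2 then c (Dyadic N (Suc j)) * ((if even k then 1 else - 1) * 2 powr (real N / 2)) else 0)"
    by (intro sum.cong refl) (simp add: haar_Dyadic_on_cell[OF Suc.prems(1)])
  also have "\<dots> = c (Dyadic N (Suc (k div 2))) * ((if even k then 1 else - 1) * 2 powr (real N / 2))"
    using k by simp
  finally show ?case
    using Suc.IH[OF dyadic_cell_Suc[OF Suc.prems(1)] k] by (simp add: sum_haar_indices_Suc)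
qed

section \<open>Haar multipliers\<close>

lemma finite_measure_unit: "finite_measure unit_measure"
  by (rule finite_measure_lebesgue_on) simp

lemma integrable_const_unit [simp]: "integrable unit_measure (\<lambda>x. c :: real)"
  using finite_measure.integrable_const[OF finite_measure_unit] .

lemma borel_measurable_unit:
  "f \<in> borel_measurable borel \<Longrightarrow> f \<in> borel_measurable unit_measure"
  for f :: "real \<Rightarrow> real"
  by (intro measurable_restrict_space1 measurable_completion) simp

lemma sets_unit_dyadic_cell [simp]: "k < 2 ^ n \<Longrightarrow> dyadic_cell n k \<in> sets unit_measure"
proof -
  assume "k < 2 ^ n"
  then have "dyadic_cell n k \<subseteq> {0..1}" using dyadic_cell_subset by fastforce
  moreover have "dyadic_cell n k \<in> sets lebesgue" by (simp add: dyadic_cell_def)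
  ultimately show ?thesis by (subst sets_restrict_space_iff) auto
qed

lemma measure_unit_dyadic_cell: "k < 2 ^ n \<Longrightarrow> measure unit_measure (dyadic_cell n k) = 1 / 2 ^ n"
proof -
  assume k: "k < 2 ^ n"
  have "measure unit_measure (dyadic_cell n k) = measure lebesgue (dyadic_cell n k)"
    using dyadic_cell_subset[OF k] by (intro measure_restrict_space) auto
  also have "\<dots> = measure lborel (dyadic_cell n k)"
    by (rule measure_completion) (simp add: dyadic_cell_def)
  also have "\<dots> = 1 / 2 ^ n"
    by (simp add: dyadic_cell_def field_simps)
  finally show ?thesis .
qed

lemma integral_indicator_dyadic_cell:
  assumes "k < 2 ^ n"
  shows "integrable unit_measure (indicator (dyadic_cell n k) :: real \<Rightarrow> real)"
    and "(LINT x|unit_measure. indicator (dyadic_cell n k) x) = (1 / 2 ^ n :: real)"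
proof -
  have sub: "dyadic_cell n k \<inter> space unit_measure = dyadic_cell n k"
    using dyadic_cell_subset[OF assms] by auto
  show "integrable unit_measure (indicator (dyadic_cell n k) :: real \<Rightarrow> real)"
    using integrable_real_mult_indicator[OF sets_unit_dyadic_cell[OF assms] integrable_const_unit[of 1]] by simp
  show "(LINT x|unit_measure. indicator (dyadic_cell n k) x) = (1 / 2 ^ n :: real)"
    using measure_unit_dyadic_cell[OF assms] sub by simp
qed

text \<open>The half-open cells leave out the endpoint 1. Prescribing the value there makes the
  decomposition into indicators hold at every point of the space.\<close>

lemma integral_step_function:
  fixes F :: "real \<Rightarrow> real"
  assumes "\<And>k x. k < 2 ^ N \<Longrightarrow> x \<in> dyadic_cell N k \<Longrightarrow> F x = v k" and "F 1 = 0"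
  shows "(LINT x|unit_measure. F x) = (\<Sum>k<2 ^ N. v k) / 2 ^ N"
proof -
  have eq: "F x = (\<Sum>k<2 ^ N. v k * indicator (dyadic_cell N k) x)" if x: "x \<in> space unit_measure" for x
  proof (cases "x = 1")
    case True
    have "x \<notin> dyadic_cell N k" if "k < 2 ^ N" for k
      using dyadic_cell_subset[OF that] True by auto
    then show ?thesis using True assms(2) by simp
  next
    case False
    then obtain k where k: "k < 2 ^ N" "x \<in> dyadic_cell N k"
      using ex_dyadic_cell[of x N] x by auto
    have "(\<Sum>j<2 ^ N. v j * indicator (dyadic_cell N j) x) = (\<Sum>j<2 ^ N. if j = k then v j else 0)"
      by (intro sum.cong) (auto simp: indicator_dyadic_cell[OF k(2)])
    then show ?thesis using assms(1)[OF k] k by simp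
  qed
  have "(LINT x|unit_measure. F x) = (LINT x|unit_measure. (\<Sum>k<2 ^ N. v k * indicator (dyadic_cell N k) x))"
    by (intro Bochner_Integration.integral_cong eq refl)
  also have "\<dots> = (\<Sum>k<2 ^ N. LINT x|unit_measure. v k * indicator (dyadic_cell N k) x)"
    by (intro Bochner_Integration.integral_sum integrable_mult_right integral_indicator_dyadic_cell) auto
  also have "\<dots> = (\<Sum>k<2 ^ N. v k * (1 / 2 ^ N))"
    using integral_indicator_dyadic_cell(2)[of _ N] by (intro sum.cong refl) simp
  finally show ?thesis by (simp add: sum_divide_distrib)
qed

lemma haar_at_1: "I \<in> dyadic_intervals \<Longrightarrow> haar I 1 = 0"
proof -
  assume "I \<in> dyadic_intervals"
  then consider "I = Whole" | n k where "I = Dyadic n (Suc k)" "Suc k \<le> 2 ^ n"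
    by (auto simp: dyadic_intervals_def) (metis Suc_le_D)
  then show ?thesis
  proof cases
    case 1
    then show ?thesis by (simp add: haar_Whole_eq dyadic_cell_def)
  next
    case (2 n k)
    then have "2 * k < 2 ^ Suc n" "Suc (2 * k) < 2 ^ Suc n" by auto
    then have "1 \<notin> dyadic_cell (Suc n) (2 * k)" "1 \<notin> dyadic_cell (Suc n) (Suc (2 * k))"
      using dyadic_cell_subset by fastforce+
    then show ?thesis using 2 by (simp add: haar_Dyadic_Suc)
  qed
qed

lemma haar_indices_subset: "haar_indices N \<subseteq> dyadic_intervals"
  by (auto simp: haar_indices_def dyadic_intervals_def)

lemma integral_haar_sum_powr:
  "(LINT x|unit_measure. \<bar>\<Sum>I\<in>haar_indices N. c I * haar I x\<bar> powr p)
    = (\<Sum>k<2 ^ N. \<bar>dyadic_value c N k\<bar> powr p) / 2 ^ N"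
proof (rule integral_step_function)
  fix k x assume "k < 2 ^ N" "x \<in> dyadic_cell N k"
  then show "\<bar>\<Sum>I\<in>haar_indices N. c I * haar I x\<bar> powr p = \<bar>dyadic_value c N k\<bar> powr p"
    by (simp add: haar_sum_on_cell)
next
  have "(\<Sum>I\<in>haar_indices N. c I * haar I 1) = 0"
    using haar_indices_subset[of N] by (intro sum.neutral) (auto simp: haar_at_1)
  then show "\<bar>\<Sum>I\<in>haar_indices N. c I * haar I 1\<bar> powr p = 0" by simp
qed

section \<open>Closure properties of \<open>Lp_space\<close>\<close>

lemma Lp_space_measurable: "f \<in> Lp_space p \<Longrightarrow> f \<in> borel_measurable unit_measure"
  and Lp_space_integrable_powr: "f \<in> Lp_space p \<Longrightarrow> integrable unit_measure (\<lambda>x. \<bar>f x\<bar> powr p)"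
  by (auto simp: Lp_space_def)

lemma Lp_space_integrable:
  assumes "1 < p" "f \<in> Lp_space p"
  shows "integrable unit_measure f"
proof (rule Bochner_Integration.integrable_bound)
  show "integrable unit_measure (\<lambda>x. 1 + \<bar>f x\<bar> powr p)"
    using Lp_space_integrable_powr[OF assms(2)] by (intro Bochner_Integration.integrable_add) simp_all
  have "\<bar>t\<bar> \<le> 1 + \<bar>t\<bar> powr p" for t :: real
  proof (cases "\<bar>t\<bar> \<le> 1")
    case True
    then show ?thesis using powr_ge_zero[of "\<bar>t\<bar>" p] by linarith
  next
    case False
    then show ?thesis using powr_mono[of 1 p "\<bar>t\<bar>"] assms(1) by simp
  qed
  then show "AE x in unit_measure. norm (f x) \<le> norm (1 + \<bar>f x\<bar> powr p)"
    by (intro AE_I2) (metis abs_of_nonneg add_nonneg_nonneg powr_ge_zero real_norm_def zero_le_one)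
qed (use assms Lp_space_measurable in auto)

lemma Lp_space_cmult: "f \<in> Lp_space p \<Longrightarrow> (\<lambda>x. c * f x) \<in> Lp_space p"
  by (auto simp: Lp_space_def abs_mult powr_mult)

lemma Lp_space_add:
  assumes "1 < p" "f \<in> Lp_space p" "g \<in> Lp_space p"
  shows "(\<lambda>x. f x + g x) \<in> Lp_space p"
proof -
  have meas: "(\<lambda>x. f x + g x) \<in> borel_measurable unit_measure"
    using assms by (intro borel_measurable_add Lp_space_measurable)
  have "integrable unit_measure (\<lambda>x. \<bar>f x + g x\<bar> powr p)"
  proof (rule Bochner_Integration.integrable_bound)
    show "integrable unit_measure (\<lambda>x. 2 powr p * (\<bar>f x\<bar> powr p + \<bar>g x\<bar> powr p))"
      using assms by (intro integrable_mult_right Bochner_Integration.integrable_add Lp_space_integrable_powr)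
    show "(\<lambda>x. \<bar>f x + g x\<bar> powr p) \<in> borel_measurable unit_measure"
      using meas by measurable
    have "\<bar>u + v\<bar> powr p \<le> 2 powr p * (\<bar>u\<bar> powr p + \<bar>v\<bar> powr p)" for u v :: real
    proof -
      have "\<bar>u + v\<bar> powr p = 2 powr p * \<bar>(u + v) / 2\<bar> powr p"
        by (simp flip: powr_mult)
      also have "\<dots> \<le> 2 powr p * (2 * \<bar>(u + v) / 2\<bar> powr p)"
        by (intro mult_left_mono) (use powr_ge_zero[of "\<bar>(u + v) / 2\<bar>" p] in linarith, simp)
      also have "\<dots> \<le> 2 powr p * (\<bar>u\<bar> powr p + \<bar>v\<bar> powr p)"
        by (intro mult_left_mono abs_powr_midpoint assms) simp
      finally show ?thesis .
    qed
    then show "AE x in unit_measure. norm (\<bar>f x + g x\<bar> powr p) \<le> norm (2 powr p * (\<bar>f x\<bar> powr p + \<bar>g x\<bar> powr p))"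
      by (intro AE_I2) (simp add: abs_mult)
  qed
  then show ?thesis using meas by (simp add: Lp_space_def)
qed

lemma Lp_space_sum:
  assumes "1 < p" "\<And>i. i \<in> A \<Longrightarrow> f i \<in> Lp_space p"
  shows "(\<lambda>x. \<Sum>i\<in>A. f i x) \<in> Lp_space p"
  using assms(2)
proof (induction A rule: infinite_finite_induct)
  case (insert i A)
  then show ?case using assms(1) by (auto intro!: Lp_space_add)
qed (use assms(1) in \<open>auto simp: Lp_space_def\<close>)

lemma haar_measurable [measurable]: "haar I \<in> borel_measurable borel"
proof (cases I)
  case Whole
  then show ?thesis by (simp add: haar_Whole_eq dyadic_cell_def)
next
  case (Dyadic n j)
  show ?thesis unfolding Dyadic haar.simps by measurable
qed

lemma haar_Lp: "haar I \<in> Lp_space p" if "1 < p"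
proof -
  have meas: "haar I \<in> borel_measurable unit_measure"
    by (intro borel_measurable_unit haar_measurable)
  obtain B where B: "\<And>x. \<bar>haar I x\<bar> \<le> B"
  proof (cases I)
    case Whole
    then show ?thesis using that[of 1] by (auto simp: haar.simps)
  next
    case (Dyadic n j)
    show ?thesis by (rule that[of "2 powr (real n / 2)"]) (auto simp: Dyadic haar.simps)
  qed
  have "integrable unit_measure (\<lambda>x. \<bar>haar I x\<bar> powr p)"
  proof (rule Bochner_Integration.integrable_bound[OF integrable_const_unit[of "B powr p"]])
    show "AE x in unit_measure. norm (\<bar>haar I x\<bar> powr p) \<le> norm (B powr p)"
      using B \<open>1 < p\<close> by (intro AE_I2) (auto intro!: powr_mono2)
  qed (use meas in measurable)
  then show ?thesis using meas by (simp add: Lp_space_def)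
qed

lemma Lp_space_diff_haar_sum:
  assumes "1 < p" "g \<in> Lp_space p"
  shows "(\<lambda>x. g x - (\<Sum>I\<in>Q. a I * haar I x)) \<in> Lp_space p"
proof -
  have "(\<lambda>x. g x + - 1 * (\<Sum>I\<in>Q. a I * haar I x)) \<in> Lp_space p"
    using assms by (intro Lp_space_add Lp_space_cmult Lp_space_sum haar_Lp) auto
  then show ?thesis by simp
qed

section \<open>Conditional expectations on cells and bounds for multipliers\<close>

text \<open>The partial Haar sum of \<open>h\<close> is its conditional expectation on the cells of
  level \<open>N\<close>. In the induction, the new coefficient measures the difference of the
  integrals over the two halves, which corrects the average over the parent to that over the
  child.\<close>

lemma dyadic_value_haar_coeff:
  assumes "integrable unit_measure h" "k < 2 ^ N"
  shows "dyadic_value (haar_coeff h) N k = 2 ^ N * (LINT x|unit_measure. h x * indicator (dyadic_cell N k) x)"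
  using assms(2)
proof (induction N arbitrary: k)
  case 0
  then show ?case by (simp add: haar_coeff_def haar_Whole_eq)
next
  case (Suc N)
  define j where "j = k div 2"
  have j: "j < 2 ^ N" using Suc.prems by (simp add: j_def)
  then have j: "j < 2 ^ N" "2 * j < 2 ^ Suc N" "Suc (2 * j) < 2 ^ Suc N"
    unfolding power_Suc by linarith+
  define A where "A i = (LINT x|unit_measure. h x * indicator (dyadic_cell (Suc N) i) x)" for i
  have int: "integrable unit_measure (\<lambda>x. h x * indicator (dyadic_cell (Suc N) i) x)" if "i < 2 ^ Suc N" for i
    using that assms(1) by (intro integrable_real_mult_indicator sets_unit_dyadic_cell)
  have "(LINT x|unit_measure. h x * indicator (dyadic_cell N j) x)
      = (LINT x|unit_measure. h x * indicator (dyadic_cell (Suc N) (2 * j)) x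
          + h x * indicator (dyadic_cell (Suc N) (Suc (2 * j))) x)"
    by (simp add: indicator_dyadic_cell_split[of N j] distrib_left)
  also have "\<dots> = A (2 * j) + A (Suc (2 * j))"
    unfolding A_def by (intro Bochner_Integration.integral_add int j)
  finally have avg: "(LINT x|unit_measure. h x * indicator (dyadic_cell N j) x) = A (2 * j) + A (Suc (2 * j))" .
  have "haar_coeff h (Dyadic N (Suc j))
      = (LINT x|unit_measure. 2 powr (real N / 2) * (h x * indicator (dyadic_cell (Suc N) (2 * j)) x
          - h x * indicator (dyadic_cell (Suc N) (Suc (2 * j))) x))"
    by (simp add: haar_coeff_def haar_Dyadic_Suc algebra_simps)
  also have "\<dots> = 2 powr (real N / 2) * (A (2 * j) - A (Suc (2 * j)))"
    unfolding A_def by (simp only: integral_mult_right_zero Bochner_Integration.integral_diff[OF int[OF j(2)] int[OF j(3)]])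
  finally have coeff: "haar_coeff h (Dyadic N (Suc j)) = 2 powr (real N / 2) * (A (2 * j) - A (Suc (2 * j)))" .
  have pw: "2 powr (real N / 2) * (2 powr (real N / 2) * x) = 2 ^ N * x" for x :: real
    by (simp add: powr_realpow flip: powr_add mult.assoc)
  have "dyadic_value (haar_coeff h) (Suc N) k = 2 ^ N * (A (2 * j) + A (Suc (2 * j)))
      + (if even k then 1 else - 1) * (2 ^ N * (A (2 * j) - A (Suc (2 * j))))"
    using Suc.IH[OF j(1)] by (simp add: avg coeff pw mult.assoc flip: j_def)
  also have "\<dots> = 2 ^ Suc N * A k"
  proof (cases "even k")
    case True
    then have "k = 2 * j" by (simp add: j_def)
    then show ?thesis using True by (simp add: algebra_simps)
  next
    case False
    then have "k = Suc (2 * j)" by (simp add: j_def)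
    then show ?thesis using False by (simp add: algebra_simps)
  qed
  finally show ?case by (simp add: A_def)
qed

text \<open>Jensen's inequality on one cell: the supporting line at the average \<open>v\<close> is
  integrated over the cell, and its linear term vanishes.\<close>

lemma abs_average_powr_le:
  assumes p: "1 < p" and h: "h \<in> Lp_space p" and k: "k < 2 ^ N"
  shows "\<bar>2 ^ N * (LINT x|unit_measure. h x * indicator (dyadic_cell N k) x)\<bar> powr p
    \<le> 2 ^ N * (LINT x|unit_measure. \<bar>h x\<bar> powr p * indicator (dyadic_cell N k) x)"
proof -
  define J where "J = dyadic_cell N k"
  define v where "v = 2 ^ N * (LINT x|unit_measure. h x * indicator J x)"
  obtain m where m: "\<And>y. \<bar>v\<bar> powr p + m * (y - v) \<le> \<bar>y\<bar> powr p"
    using abs_powr_supporting_line[OF p, of v] by blast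
  have J: "integrable unit_measure (indicator J :: real \<Rightarrow> real)"
    "(LINT x|unit_measure. indicator J x) = (1 / 2 ^ N :: real)"
    using integral_indicator_dyadic_cell[OF k] by (auto simp: J_def)
  have hJ: "integrable unit_measure (\<lambda>x. h x * indicator J x)"
    "integrable unit_measure (\<lambda>x. \<bar>h x\<bar> powr p * indicator J x)"
    using k Lp_space_integrable[OF p h] Lp_space_integrable_powr[OF h]
    by (auto simp: J_def intro!: integrable_real_mult_indicator)
  have "(LINT x|unit_measure. (\<bar>v\<bar> powr p - m * v) * indicator J x + m * (h x * indicator J x))
      \<le> (LINT x|unit_measure. \<bar>h x\<bar> powr p * indicator J x)"
  proof (intro integral_mono Bochner_Integration.integrable_add integrable_mult_right J hJ)
    fix x
    show "(\<bar>v\<bar> powr p - m * v) * indicator J x + m * (h x * indicator J x) \<le> \<bar>h x\<bar> powr p * indicator J x"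
      using m[of "h x"] by (auto simp: indicator_def algebra_simps)
  qed
  also have "(LINT x|unit_measure. (\<bar>v\<bar> powr p - m * v) * indicator J x + m * (h x * indicator J x))
      = (\<bar>v\<bar> powr p - m * v) * (1 / 2 ^ N) + m * (v / 2 ^ N)"
  proof (subst Bochner_Integration.integral_add)
    have "measure unit_measure (J \<inter> {0..1}) = 1 / 2 ^ N" using J(2) by simp
    then show "(LINT x|unit_measure. (\<bar>v\<bar> powr p - m * v) * indicator J x) + (LINT x|unit_measure. m * (h x * indicator J x))
        = (\<bar>v\<bar> powr p - m * v) * (1 / 2 ^ N) + m * (v / 2 ^ N)"
      by (simp add: v_def)
  qed (intro integrable_mult_right J hJ)+
  finally show ?thesis by (simp add: v_def[symmetric] field_simps flip: J_def)
qed

text \<open>Conditional expectation is a contraction of the norm, by Jensen's inequality summed over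
  the disjoint cells.\<close>

lemma sum_dyadic_value_haar_coeff_le:
  assumes p: "1 < p" and h: "h \<in> Lp_space p"
  shows "(\<Sum>k<2 ^ N. \<bar>dyadic_value (haar_coeff h) N k\<bar> powr p) / 2 ^ N \<le> (LINT x|unit_measure. \<bar>h x\<bar> powr p)"
proof -
  have int: "integrable unit_measure (\<lambda>x. \<bar>h x\<bar> powr p * indicator (dyadic_cell N k) x)" if "k < 2 ^ N" for k
    using that Lp_space_integrable_powr[OF h] by (intro integrable_real_mult_indicator) auto
  have "(\<Sum>k<2 ^ N. \<bar>dyadic_value (haar_coeff h) N k\<bar> powr p) / 2 ^ N
      \<le> (\<Sum>k<2 ^ N. 2 ^ N * (LINT x|unit_measure. \<bar>h x\<bar> powr p * indicator (dyadic_cell N k) x)) / 2 ^ N"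
    by (intro divide_right_mono sum_mono)
      (auto simp: dyadic_value_haar_coeff[OF Lp_space_integrable[OF p h]] intro!: abs_average_powr_le[OF p h])
  also have "\<dots> = (\<Sum>k<2 ^ N. LINT x|unit_measure. \<bar>h x\<bar> powr p * indicator (dyadic_cell N k) x)"
    by (simp flip: sum_distrib_left)
  also have "\<dots> = (LINT x|unit_measure. (\<Sum>k<2 ^ N. \<bar>h x\<bar> powr p * indicator (dyadic_cell N k) x))"
    by (intro Bochner_Integration.integral_sum[symmetric] int) auto
  also have "\<dots> \<le> (LINT x|unit_measure. \<bar>h x\<bar> powr p)"
  proof (intro integral_mono Bochner_Integration.integrable_sum int Lp_space_integrable_powr[OF h])
    fix x
    show "(\<Sum>k<2 ^ N. \<bar>h x\<bar> powr p * indicator (dyadic_cell N k) x) \<le> \<bar>h x\<bar> powr p"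
    proof (cases "\<exists>k<2 ^ N. x \<in> dyadic_cell N k")
      case True
      then obtain k where k: "k < 2 ^ N" "x \<in> dyadic_cell N k" by blast
      have "(\<Sum>j<2 ^ N. \<bar>h x\<bar> powr p * indicator (dyadic_cell N j) x) = (\<Sum>j<2 ^ N. if j = k then \<bar>h x\<bar> powr p else 0)"
        by (intro sum.cong) (auto simp: indicator_dyadic_cell[OF k(2)])
      also have "\<dots> = \<bar>h x\<bar> powr p" using k by simp
      finally show ?thesis by (rule eq_refl)
    next
      case False
      then have "(\<Sum>k<2 ^ N. \<bar>h x\<bar> powr p * indicator (dyadic_cell N k) x) = 0"
        by (intro sum.neutral) auto
      then show ?thesis by (simp only: powr_ge_zero)
    qed
  qed auto
  finally show ?thesis .
qed

text \<open>Burkholder's bound compares the sign-changed sum with the partial sum of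
  \<open>h\<close>, and contractivity compares the latter with \<open>h\<close> itself. So
  \<open>h\<close> may be any function of the space.\<close>

lemma haar_sign_multiplier:
  assumes p: "1 < p" and h: "h \<in> Lp_space p" and \<epsilon>: "\<And>I. \<epsilon> I = 1 \<or> \<epsilon> I = - 1"
  shows "(LINT x|unit_measure. \<bar>\<Sum>I\<in>haar_indices N. \<epsilon> I * haar_coeff h I * haar I x\<bar> powr p)
    \<le> (max p (p / (p - 1)) - 1) powr p * (LINT x|unit_measure. \<bar>h x\<bar> powr p)"
proof -
  have "(LINT x|unit_measure. \<bar>\<Sum>I\<in>haar_indices N. \<epsilon> I * haar_coeff h I * haar I x\<bar> powr p)
      = (\<Sum>k<2 ^ N. \<bar>dyadic_value (\<lambda>I. \<epsilon> I * haar_coeff h I) N k\<bar> powr p) / 2 ^ N"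
    by (rule integral_haar_sum_powr)
  also have "\<dots> \<le> (max p (p / (p - 1)) - 1) powr p * (\<Sum>k<2 ^ N. \<bar>dyadic_value (haar_coeff h) N k\<bar> powr p) / 2 ^ N"
    by (intro divide_right_mono sum_dyadic_value_sign_le p \<epsilon>) auto
  also have "\<dots> = (max p (p / (p - 1)) - 1) powr p * ((\<Sum>k<2 ^ N. \<bar>dyadic_value (haar_coeff h) N k\<bar> powr p) / 2 ^ N)"
    by simp
  also have "\<dots> \<le> (max p (p / (p - 1)) - 1) powr p * (LINT x|unit_measure. \<bar>h x\<bar> powr p)"
    by (intro mult_left_mono sum_dyadic_value_haar_coeff_le p h) simp
  finally show ?thesis .
qed

lemma haar_sum_integrable_powr:
  "1 < p \<Longrightarrow> integrable unit_measure (\<lambda>x. \<bar>\<Sum>I\<in>Q. c I * haar I x\<bar> powr p)"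
  by (intro Lp_space_integrable_powr Lp_space_sum Lp_space_cmult haar_Lp)

text \<open>A multiplier with values in -1, 0, 1 is the average of two sign multipliers, so
  convexity carries the bound over with the same constant. The value 0 makes projections a special
  case.\<close>

lemma haar_multiplier:
  assumes p: "1 < p" and h: "h \<in> Lp_space p" and \<theta>: "\<And>I. \<theta> I \<in> {- 1, 0, 1}"
    and Q: "finite Q" "Q \<subseteq> dyadic_intervals"
  shows "(LINT x|unit_measure. \<bar>\<Sum>I\<in>Q. \<theta> I * haar_coeff h I * haar I x\<bar> powr p)
    \<le> (max p (p / (p - 1)) - 1) powr p * (LINT x|unit_measure. \<bar>h x\<bar> powr p)" (is "?L \<le> ?R")
proof -
  obtain N where N: "Q \<subseteq> haar_indices N" using finite_subset_haar_indices[OF Q] by blast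
  \<comment> \<open>Wherever the multiplier is 0, and everywhere outside \<open>Q\<close>, the sign
    is \<open>s\<close>. The choices \<open>s = 1\<close> and \<open>s = - 1\<close> cancel there
    and agree elsewhere.\<close>
  define \<epsilon> where "\<epsilon> s I = (if I \<in> Q \<and> \<theta> I \<noteq> 0 then \<theta> I else s)" for s :: real and I
  define T where "T s x = (\<Sum>I\<in>haar_indices N. \<epsilon> s I * haar_coeff h I * haar I x)" for s x
  have sign: "(LINT x|unit_measure. \<bar>T s x\<bar> powr p) \<le> ?R" if "s = 1 \<or> s = - 1" for s
    unfolding T_def by (rule haar_sign_multiplier[OF p h]) (use \<theta> that in \<open>auto simp: \<epsilon>_def\<close>)
  have int: "integrable unit_measure (\<lambda>x. \<bar>T s x\<bar> powr p)" for s
    unfolding T_def by (rule haar_sum_integrable_powr[OF p])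
  have avg: "(\<Sum>I\<in>Q. \<theta> I * haar_coeff h I * haar I x) = (T 1 x + T (- 1) x) / 2" for x
  proof -
    have "T 1 x + T (- 1) x = (\<Sum>I\<in>haar_indices N. (\<epsilon> 1 I + \<epsilon> (- 1) I) * haar_coeff h I * haar I x)"
      by (simp add: T_def sum.distrib distrib_right)
    also have "\<dots> = (\<Sum>I\<in>Q. (\<epsilon> 1 I + \<epsilon> (- 1) I) * haar_coeff h I * haar I x)"
      using N by (intro sum.mono_neutral_right) (auto simp: \<epsilon>_def)
    also have "\<dots> = (\<Sum>I\<in>Q. 2 * (\<theta> I * haar_coeff h I * haar I x))"
      by (intro sum.cong) (auto simp: \<epsilon>_def)
    finally show ?thesis by (simp flip: sum_distrib_left)
  qed
  have "2 * ?L = (LINT x|unit_measure. 2 * \<bar>(T 1 x + T (- 1) x) / 2\<bar> powr p)"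
    by (simp add: avg)
  also have "\<dots> \<le> (LINT x|unit_measure. \<bar>T 1 x\<bar> powr p + \<bar>T (- 1) x\<bar> powr p)"
  proof (intro integral_mono Bochner_Integration.integrable_add integrable_mult_right int abs_powr_midpoint p)
    show "integrable unit_measure (\<lambda>x. \<bar>(T 1 x + T (- 1) x) / 2\<bar> powr p)"
      unfolding avg[symmetric] by (rule haar_sum_integrable_powr[OF p])
  qed
  also have "\<dots> = (LINT x|unit_measure. \<bar>T 1 x\<bar> powr p) + (LINT x|unit_measure. \<bar>T (- 1) x\<bar> powr p)"
    by (intro Bochner_Integration.integral_add int)
  finally show ?thesis using sign[of 1] sign[of "- 1"] by simp
qed

section \<open>Greedy approximation\<close>

text \<open>The sum of the values on the two halves of a cell determines the parent value, and their
  difference determines the coefficient. So the coefficients are recovered level by level.\<close>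

lemma dyadic_value_inject:
  assumes "\<And>k. k < 2 ^ N \<Longrightarrow> dyadic_value c N k = dyadic_value d N k" and "I \<in> haar_indices N"
  shows "c I = d I"
  using assms
proof (induction N)
  case 0
  then show ?case by (auto simp: haar_indices_0)
next
  case (Suc N)
  have eq: "dyadic_value c N k = dyadic_value d N k \<and> c (Dyadic N (Suc k)) = d (Dyadic N (Suc k))"
    if "k < 2 ^ N" for k
  proof -
    have "2 * k < 2 ^ Suc N" "Suc (2 * k) < 2 ^ Suc N" using that unfolding power_Suc by linarith+
    then have "dyadic_value c N k + 2 powr (real N / 2) * c (Dyadic N (Suc k))
        = dyadic_value d N k + 2 powr (real N / 2) * d (Dyadic N (Suc k))"
      "dyadic_value c N k - 2 powr (real N / 2) * c (Dyadic N (Suc k))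
        = dyadic_value d N k - 2 powr (real N / 2) * d (Dyadic N (Suc k))"
      using Suc.prems(1)[of "2 * k"] Suc.prems(1)[of "Suc (2 * k)"] by simp_all
    then have "dyadic_value c N k = dyadic_value d N k"
      "2 powr (real N / 2) * c (Dyadic N (Suc k)) = 2 powr (real N / 2) * d (Dyadic N (Suc k))"
      by linarith+
    then show ?thesis by simp
  qed
  show ?case
  proof (cases "I \<in> haar_indices N")
    case True
    then show ?thesis using Suc.IH eq by blast
  next
    case False
    then obtain j where j: "I = Dyadic N j" "1 \<le> j" "j \<le> 2 ^ N"
      using Suc.prems(2) by (auto simp: haar_indices_def less_Suc_eq)
    then show ?thesis using eq[of "j - 1"] by simp
  qed
qed

text \<open>Orthonormality of the Haar system without computing inner products: the computed and the
  given coefficients have the same cell values, hence are equal.\<close>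

lemma haar_coeff_haar_sum:
  assumes Q: "finite Q" "Q \<subseteq> dyadic_intervals" and I: "I \<in> dyadic_intervals"
  shows "haar_coeff (\<lambda>x. \<Sum>J\<in>Q. a J * haar J x) I = (if I \<in> Q then a I else 0)"
proof -
  define s where "s x = (\<Sum>J\<in>Q. a J * haar J x)" for x
  define b where "b J = (if J \<in> Q then a J else 0)" for J
  obtain N where N: "insert I Q \<subseteq> haar_indices N"
    using finite_subset_haar_indices[of "insert I Q"] Q I by auto
  have s: "s x = (\<Sum>J\<in>haar_indices N. b J * haar J x)" for x
    unfolding s_def b_def using N by (intro sum.mono_neutral_cong_left) auto
  \<comment> \<open>Any exponent above 1 would serve, as the aim is integrability of
    \<open>s\<close>.\<close>
  have "s \<in> Lp_space 2"
    unfolding s_def by (intro Lp_space_sum Lp_space_cmult haar_Lp) auto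
  then have int: "integrable unit_measure s" by (intro Lp_space_integrable[of 2]) auto
  have "haar_coeff s I = b I"
  proof (rule dyadic_value_inject)
    fix k :: nat assume k: "k < 2 ^ N"
    have "(LINT x|unit_measure. s x * indicator (dyadic_cell N k) x)
        = (LINT x|unit_measure. dyadic_value b N k * indicator (dyadic_cell N k) x)"
      by (intro Bochner_Integration.integral_cong refl)
        (auto simp: indicator_def s haar_sum_on_cell[OF _ k])
    also have "\<dots> = dyadic_value b N k / 2 ^ N"
      using integral_indicator_dyadic_cell(2)[OF k] by simp
    finally show "dyadic_value (haar_coeff s) N k = dyadic_value b N k"
      by (simp add: dyadic_value_haar_coeff[OF int k])
  qed (use N in auto)
  then show ?thesis by (simp add: s_def[abs_def] b_def)
qed

section \<open>Levels, supports and sizes of Haar terms\<close>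

fun haar_level :: "haar_index \<Rightarrow> nat" where
  "haar_level Whole = 0"
| "haar_level (Dyadic n j) = n"

fun haar_support :: "haar_index \<Rightarrow> real set" where
  "haar_support Whole = dyadic_cell 0 0"
| "haar_support (Dyadic n j) = dyadic_cell n (j - 1)"

lemma dyadic_intervals_cases:
  assumes "I \<in> dyadic_intervals"
  obtains "I = Whole" | n k where "I = Dyadic n (Suc k)" "k < 2 ^ n"
proof -
  have "\<exists>k. j = Suc k \<and> k < 2 ^ n" if "1 \<le> j" "j \<le> 2 ^ n" for j n
    using that by (intro exI[of _ "j - 1"]) auto
  then show thesis using assms that by (auto simp: dyadic_intervals_def)
qed

lemma haar_support_cell:
  assumes "I \<in> dyadic_intervals"
  obtains k where "k < 2 ^ haar_level I" "haar_support I = dyadic_cell (haar_level I) k"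
  using assms that by (cases rule: dyadic_intervals_cases) auto

lemma abs_haar:
  assumes "I \<in> dyadic_intervals"
  shows "\<bar>haar I x\<bar> = 2 powr (real (haar_level I) / 2) * indicator (haar_support I) x"
  using assms
proof (cases rule: dyadic_intervals_cases)
  case 1
  then show ?thesis by (simp add: haar_Whole_eq)
next
  case (2 n k)
  have "x \<notin> dyadic_cell (Suc n) (2 * k) \<or> x \<notin> dyadic_cell (Suc n) (Suc (2 * k))"
    using dyadic_cell_unique[of x "Suc n" "2 * k" "Suc (2 * k)"] by auto
  then show ?thesis
    by (auto simp: 2 haar_Dyadic_Suc indicator_dyadic_cell_split[of n k] abs_mult)
qed

lemma integrable_mult_haar:
  assumes "integrable unit_measure h" "I \<in> dyadic_intervals"
  shows "integrable unit_measure (\<lambda>x. h x * haar I x)"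
  using assms(2)
proof (cases rule: dyadic_intervals_cases)
  case 1
  then show ?thesis
    using integrable_real_mult_indicator[OF sets_unit_dyadic_cell[of 0 0] assms(1)] by (simp add: haar_Whole_eq)
next
  case (2 n k)
  then have "2 * k < 2 ^ Suc n" "Suc (2 * k) < 2 ^ Suc n" unfolding power_Suc by linarith+
  then have "integrable unit_measure (\<lambda>x. 2 powr (real n / 2) * (h x * indicator (dyadic_cell (Suc n) (2 * k)) x
      - h x * indicator (dyadic_cell (Suc n) (Suc (2 * k))) x))"
    by (intro integrable_mult_right Bochner_Integration.integrable_diff integrable_real_mult_indicator
        sets_unit_dyadic_cell assms)
  then show ?thesis by (simp add: 2 haar_Dyadic_Suc algebra_simps)
qed

lemma haar_coeff_diff:
  assumes "integrable unit_measure f" "integrable unit_measure g" "I \<in> dyadic_intervals"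
  shows "haar_coeff (\<lambda>x. f x - g x) I = haar_coeff f I - haar_coeff g I"
  unfolding haar_coeff_def left_diff_distrib
  by (intro Bochner_Integration.integral_diff integrable_mult_haar assms)

text \<open>The index \<open>Whole\<close> shares level \<open>0\<close> with \<open>Dyadic 0 1\<close>; the bound \<open>z \<le> 2\<close> absorbs this
  extra term.\<close>

lemma sum_chain_le:
  fixes z :: real
  assumes z: "1 < z" "z \<le> 2" and K: "finite K" "K \<subseteq> dyadic_intervals" "\<And>I. I \<in> K \<Longrightarrow> x \<in> haar_support I"
    and n: "\<And>I. I \<in> K \<Longrightarrow> haar_level I \<le> n"
  shows "(\<Sum>I\<in>K. z ^ haar_level I) \<le> z / (z - 1) * z ^ n"
proof -
  \<comment> \<open>Cells of the same level that contain \<open>x\<close> coincide, so apart from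
    \<open>Whole\<close> each level occurs at most once.\<close>
  have "inj_on haar_level (K - {Whole})"
  proof (rule inj_onI)
    fix I J assume I: "I \<in> K - {Whole}" and J: "J \<in> K - {Whole}" and eq: "haar_level I = haar_level J"
    obtain n k where Ik: "I = Dyadic n (Suc k)"
      using I K(2) dyadic_intervals_cases[of I] by blast
    obtain n' k' where Jk: "J = Dyadic n' (Suc k')"
      using J K(2) dyadic_intervals_cases[of J] by blast
    have "x \<in> dyadic_cell n k" "x \<in> dyadic_cell n k'"
      using K(3)[of I] K(3)[of J] I J eq by (auto simp: Ik Jk)
    then show "I = J" using eq dyadic_cell_unique by (auto simp: Ik Jk)
  qed
  then have "(\<Sum>I\<in>K - {Whole}. z ^ haar_level I) = (\<Sum>l\<in>haar_level ` (K - {Whole}). z ^ l)"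
    by (simp add: sum.reindex)
  also have "\<dots> \<le> (\<Sum>l<Suc n. z ^ l)"
    using n z by (intro sum_mono2) (auto simp: less_Suc_eq_le)
  also have "\<dots> = (z ^ Suc n - 1) / (z - 1)"
    using z by (subst geometric_sum) auto
  finally have *: "(\<Sum>I\<in>K - {Whole}. z ^ haar_level I) \<le> (z ^ Suc n - 1) / (z - 1)" .
  have "(\<Sum>I\<in>K. z ^ haar_level I) \<le> (\<Sum>I\<in>insert Whole (K - {Whole}). z ^ haar_level I)"
    using K(1) z by (intro sum_mono2) auto
  also have "\<dots> = 1 + (\<Sum>I\<in>K - {Whole}. z ^ haar_level I)"
    using K(1) by (subst sum.insert) auto
  also have "\<dots> \<le> 1 / (z - 1) + (z ^ Suc n - 1) / (z - 1)"
    using z by (intro add_mono *) (simp add: le_divide_eq)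
  also have "\<dots> = z / (z - 1) * z ^ n"
    by (simp flip: add_divide_distrib)
  finally show ?thesis .
qed

text \<open>The weight \<open>2 ^ haar_level I\<close> is the reciprocal of the measure of the
  support, so each index contributes 1. Cardinalities thereby become integrals that can be compared
  pointwise.\<close>

lemma integral_sum_supports:
  assumes "finite Q" "Q \<subseteq> dyadic_intervals"
  shows "integrable unit_measure (\<lambda>x. \<Sum>I\<in>Q. 2 ^ haar_level I * indicator (haar_support I) x :: real)"
    and "(LINT x|unit_measure. (\<Sum>I\<in>Q. 2 ^ haar_level I * indicator (haar_support I) x)) = real (card Q)"
proof -
  have *: "integrable unit_measure (indicator (haar_support I) :: real \<Rightarrow> real)"
    "(LINT x|unit_measure. 2 ^ haar_level I * indicator (haar_support I) x) = (1 :: real)"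
    if I: "I \<in> Q" for I
  proof -
    obtain k where k: "k < 2 ^ haar_level I" "haar_support I = dyadic_cell (haar_level I) k"
      using haar_support_cell I assms by blast
    show "integrable unit_measure (indicator (haar_support I) :: real \<Rightarrow> real)"
      unfolding k(2) by (rule integral_indicator_dyadic_cell[OF k(1)])
    show "(LINT x|unit_measure. 2 ^ haar_level I * indicator (haar_support I) x) = (1 :: real)"
      using integral_indicator_dyadic_cell(2)[OF k(1)] by (simp add: k(2))
  qed
  show "integrable unit_measure (\<lambda>x. \<Sum>I\<in>Q. 2 ^ haar_level I * indicator (haar_support I) x :: real)"
    by (intro Bochner_Integration.integrable_sum integrable_mult_right *)
  have "(LINT x|unit_measure. (\<Sum>I\<in>Q. 2 ^ haar_level I * indicator (haar_support I) x))
      = (\<Sum>I\<in>Q. LINT x|unit_measure. 2 ^ haar_level I * indicator (haar_support I) x :: real)"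
    by (intro Bochner_Integration.integral_sum integrable_mult_right *)
  also have "\<dots> = (\<Sum>I\<in>Q. 1)" by (intro sum.cong refl *)
  finally show "(LINT x|unit_measure. (\<Sum>I\<in>Q. 2 ^ haar_level I * indicator (haar_support I) x)) = real (card Q)"
    by simp
qed

lemma haar_coeff_norm_nonneg: "0 \<le> haar_coeff_norm p f I"
  by (simp add: haar_coeff_norm_def Lp_norm_def)

text \<open>The modulus is constant on a support of measure \<open>1 / 2 ^ haar_level I\<close>.
  That constant is therefore the norm times the power \<open>1 / p\<close> of
  \<open>2 ^ haar_level I\<close>.\<close>

lemma abs_haar_term:
  assumes p: "1 < p" and I: "I \<in> dyadic_intervals"
  shows "\<bar>haar_coeff f I * haar I x\<bar>
    = haar_coeff_norm p f I * (2 powr (1 / p)) ^ haar_level I * indicator (haar_support I) x"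
proof -
  define A where "A = \<bar>haar_coeff f I\<bar> * 2 powr (real (haar_level I) / 2)"
  have "0 \<le> A" by (simp add: A_def)
  obtain k where k: "k < 2 ^ haar_level I" "haar_support I = dyadic_cell (haar_level I) k"
    using haar_support_cell I by blast
  have abs: "\<bar>haar_coeff f I * haar I x\<bar> = A * indicator (haar_support I) x" for x
    by (simp add: abs_mult abs_haar[OF I] A_def)
  have "\<bar>haar_coeff f I * haar I x\<bar> powr p = A powr p * indicator (haar_support I) x" for x
    unfolding abs by (auto simp: indicator_def)
  then have "haar_coeff_norm p f I = (A powr p * (1 / 2 ^ haar_level I)) powr (1 / p)"
    using integral_indicator_dyadic_cell(2)[OF k(1)] by (simp add: haar_coeff_norm_def Lp_norm_def k(2))
  also have "\<dots> = A * (1 / 2 ^ haar_level I) powr (1 / p)"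
    using p \<open>0 \<le> A\<close> by (simp only: powr_mult powr_powr) simp
  also have "(1 / 2 ^ haar_level I) powr (1 / p) = 1 / (2 powr (1 / p)) ^ haar_level I"
    by (simp add: powr_divide powr_powr mult.commute flip: powr_realpow)
  finally show ?thesis by (simp add: abs)
qed

section \<open>Upper and lower bounds for Haar sums by the number of terms\<close>

text \<open>Sign patterns are paired so that only the sign at \<open>J\<close> is kept and all
  others flip. The two sums in a pair average to \<open>a J\<close> up to sign, and midpoint
  convexity bounds its power.\<close>

lemma sum_signs_ge:
  fixes a :: "'i \<Rightarrow> real"
  assumes p: "1 < p" and Q: "finite Q" and J: "J \<in> Q"
  shows "2 ^ card Q * \<bar>a J\<bar> powr p \<le> (\<Sum>S\<in>Pow Q. \<bar>\<Sum>I\<in>Q. (if I \<in> S then 1 else - 1) * a I\<bar> powr p)"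
proof -
  define T where "T S = (\<Sum>I\<in>Q. (if I \<in> S then 1 else - 1) * a I)" for S
  \<comment> \<open>A set \<open>S\<close> lists the indices with sign 1. Membership of
    \<open>J\<close> is kept and that of every other index of \<open>Q\<close> is reversed, so
    \<open>\<phi>\<close> is an involution on \<open>Pow Q\<close>.\<close>
  define \<phi> where "\<phi> S = {I \<in> Q. (I \<in> S) = (I = J)}" for S
  have "2 * \<bar>a J\<bar> powr p \<le> \<bar>T S\<bar> powr p + \<bar>T (\<phi> S)\<bar> powr p" for S
  proof -
    have "T S + T (\<phi> S) = (\<Sum>I\<in>Q. if I = J then 2 * (if J \<in> S then 1 else - 1) * a J else 0)"
      unfolding T_def sum.distrib[symmetric] by (intro sum.cong refl) (auto simp: \<phi>_def)
    also have "\<dots> = 2 * (if J \<in> S then 1 else - 1) * a J" using Q J by simp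
    finally have "\<bar>(T S + T (\<phi> S)) / 2\<bar> = \<bar>a J\<bar>" by auto
    then show ?thesis using abs_powr_midpoint[OF p, of "T S" "T (\<phi> S)"] by simp
  qed
  then have "(\<Sum>S\<in>Pow Q. 2 * \<bar>a J\<bar> powr p) \<le> (\<Sum>S\<in>Pow Q. \<bar>T S\<bar> powr p + \<bar>T (\<phi> S)\<bar> powr p)"
    by (intro sum_mono)
  also have "\<dots> = (\<Sum>S\<in>Pow Q. \<bar>T S\<bar> powr p) + (\<Sum>S\<in>Pow Q. \<bar>T (\<phi> S)\<bar> powr p)"
    by (rule sum.distrib)
  also have "(\<Sum>S\<in>Pow Q. \<bar>T (\<phi> S)\<bar> powr p) = (\<Sum>S\<in>Pow Q. \<bar>T S\<bar> powr p)"
    by (rule sum.reindex_bij_witness[of _ \<phi> \<phi>]) (auto simp: \<phi>_def)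
  finally show ?thesis using Q by (simp add: T_def card_Pow)
qed

text \<open>The indices whose support contains a point \<open>x\<close> form a chain, along which
  the terms are at most \<open>\<mu> * z ^ haar_level I\<close>. The geometric sum is controlled by
  the deepest level \<open>n\<close>. Since \<open>(z ^ n) powr p = 2 ^ n\<close> is one summand of
  the weighted sum of indicators, integration yields the cardinality.\<close>

lemma haar_sum_upper:
  fixes p \<mu> :: real
  assumes p: "1 < p" and Q: "finite Q" "Q \<subseteq> dyadic_intervals" and "0 \<le> \<mu>"
    and \<mu>: "\<And>I. I \<in> Q \<Longrightarrow> haar_coeff_norm p f I \<le> \<mu>"
  defines "z \<equiv> 2 powr (1 / p)"
  shows "(LINT x|unit_measure. \<bar>\<Sum>I\<in>Q. haar_coeff f I * haar I x\<bar> powr p)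
    \<le> (z / (z - 1)) powr p * (\<mu> powr p * real (card Q))"
proof -
  have z: "1 < z" "z \<le> 2" using p powr_mono[of "1 / p" 1 2] by (auto simp: z_def)
  have zn: "(z ^ n) powr p = 2 ^ n" for n
    using p by (simp add: z_def powr_powr flip: powr_realpow)
  have "(LINT x|unit_measure. \<bar>\<Sum>I\<in>Q. haar_coeff f I * haar I x\<bar> powr p)
      \<le> (LINT x|unit_measure. (\<mu> * (z / (z - 1))) powr p * (\<Sum>I\<in>Q. 2 ^ haar_level I * indicator (haar_support I) x))"
  proof (intro integral_mono haar_sum_integrable_powr p integrable_mult_right integral_sum_supports Q)
    fix x
    define K where "K = {I \<in> Q. x \<in> haar_support I}"
    have K: "finite K" "K \<subseteq> dyadic_intervals" using Q by (auto simp: K_def)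
    show "\<bar>\<Sum>I\<in>Q. haar_coeff f I * haar I x\<bar> powr p
        \<le> (\<mu> * (z / (z - 1))) powr p * (\<Sum>I\<in>Q. 2 ^ haar_level I * indicator (haar_support I) x)"
    proof (cases "K = {}")
      case True
      then have "haar I x = 0" if "I \<in> Q" for I
        using abs_haar[of I x] that Q(2) by (auto simp: K_def)
      then have "(\<Sum>I\<in>Q. haar_coeff f I * haar I x) = 0"
        by (intro sum.neutral) auto
      then show ?thesis by (simp add: sum_nonneg)
    next
      case False
      define n where "n = Max (haar_level ` K)"
      have "n \<in> haar_level ` K" using K False by (auto simp: n_def)
      then obtain I\<^sub>0 where I0: "I\<^sub>0 \<in> K" "haar_level I\<^sub>0 = n" by blast
      have chain: "(\<Sum>I\<in>K. z ^ haar_level I) \<le> z / (z - 1) * z ^ n"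
        by (rule sum_chain_le[OF z K, of x]) (use K in \<open>auto simp: K_def n_def\<close>)
      have "\<bar>\<Sum>I\<in>Q. haar_coeff f I * haar I x\<bar> \<le> (\<Sum>I\<in>Q. \<bar>haar_coeff f I * haar I x\<bar>)"
        by (rule sum_abs)
      also have "\<dots> \<le> (\<Sum>I\<in>Q. \<mu> * z ^ haar_level I * indicator (haar_support I) x)"
      proof (rule sum_mono)
        fix I assume "I \<in> Q"
        then show "\<bar>haar_coeff f I * haar I x\<bar> \<le> \<mu> * z ^ haar_level I * indicator (haar_support I) x"
          using Q(2) \<mu> z unfolding z_def
          by (subst abs_haar_term[OF p]) (auto intro!: mult_right_mono)
      qed
      also have "\<dots> = (\<Sum>I\<in>K. \<mu> * z ^ haar_level I)"
        using Q by (intro sum.mono_neutral_cong_right) (auto simp: K_def indicator_def)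
      also have "\<dots> \<le> \<mu> * (z / (z - 1) * z ^ n)"
        unfolding sum_distrib_left[symmetric] using \<open>0 \<le> \<mu>\<close> chain by (rule mult_left_mono[rotated])
      also have "\<dots> = \<mu> * (z / (z - 1)) * z ^ n" by simp
      finally have "\<bar>\<Sum>I\<in>Q. haar_coeff f I * haar I x\<bar> powr p \<le> (\<mu> * (z / (z - 1)) * z ^ n) powr p"
        using p by (intro powr_mono2) auto
      also have "\<dots> = (\<mu> * (z / (z - 1))) powr p * 2 ^ n"
        using z \<open>0 \<le> \<mu>\<close> by (subst powr_mult) (auto simp: zn)
      also have "2 ^ n \<le> (\<Sum>I\<in>Q. 2 ^ haar_level I * indicator (haar_support I) x :: real)"
      proof -
        have "2 ^ haar_level I\<^sub>0 * indicator (haar_support I\<^sub>0) x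
            \<le> (\<Sum>I\<in>Q. 2 ^ haar_level I * indicator (haar_support I) x :: real)"
          using I0 Q by (intro member_le_sum) (auto simp: K_def)
        then show ?thesis using I0 by (simp add: K_def)
      qed
      finally show ?thesis by (simp add: mult_left_mono)
    qed
  qed
  also have "\<dots> = (\<mu> * (z / (z - 1))) powr p * real (card Q)"
    by (simp only: integral_mult_right_zero integral_sum_supports(2)[OF Q])
  also have "\<dots> = (z / (z - 1)) powr p * (\<mu> powr p * real (card Q))"
    using z \<open>0 \<le> \<mu>\<close> by (subst powr_mult) auto
  finally show ?thesis .
qed

text \<open>At each point the average over all signs dominates the deepest term of the chain, which
  in turn dominates the whole weighted sum of indicators up to a factor 2. After integration the
  multiplier bound applies to every sign pattern.\<close>

lemma haar_sum_lower:
  fixes p \<mu> :: real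
  assumes p: "1 < p" and h: "h \<in> Lp_space p" and Q: "finite Q" "Q \<subseteq> dyadic_intervals" and "0 \<le> \<mu>"
    and \<mu>: "\<And>I. I \<in> Q \<Longrightarrow> \<mu> \<le> haar_coeff_norm p h I"
  shows "\<mu> powr p * real (card Q)
    \<le> 2 * ((max p (p / (p - 1)) - 1) powr p * (LINT x|unit_measure. \<bar>h x\<bar> powr p))" (is "_ \<le> 2 * ?R")
proof -
  define z where "z = 2 powr (1 / p)"
  have z: "0 < z" by (simp add: z_def)
  have zn: "(z ^ n) powr p = 2 ^ n" for n
    using p by (simp add: z_def powr_powr flip: powr_realpow)
  define T where "T S x = (\<Sum>I\<in>Q. (if I \<in> S then 1 else - 1) * haar_coeff h I * haar I x)" for S x
  have int: "integrable unit_measure (\<lambda>x. \<bar>T S x\<bar> powr p)" for S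
    unfolding T_def by (rule haar_sum_integrable_powr[OF p])
  \<comment> \<open>The factor \<open>2 ^ card Q\<close> counts the sign patterns and cancels at the
    end.\<close>
  have "2 ^ card Q * (\<mu> powr p * real (card Q))
      = (LINT x|unit_measure. 2 ^ card Q * (\<mu> powr p * (\<Sum>I\<in>Q. 2 ^ haar_level I * indicator (haar_support I) x)))"
    by (simp only: integral_mult_right_zero integral_sum_supports(2)[OF Q])
  also have "\<dots> \<le> (LINT x|unit_measure. 2 * (\<Sum>S\<in>Pow Q. \<bar>T S x\<bar> powr p))"
  proof (intro integral_mono integrable_mult_right integral_sum_supports Q Bochner_Integration.integrable_sum int)
    fix x
    define K where "K = {I \<in> Q. x \<in> haar_support I}"
    have K: "finite K" "K \<subseteq> dyadic_intervals" using Q by (auto simp: K_def)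
    show "2 ^ card Q * (\<mu> powr p * (\<Sum>I\<in>Q. 2 ^ haar_level I * indicator (haar_support I) x))
        \<le> 2 * (\<Sum>S\<in>Pow Q. \<bar>T S x\<bar> powr p)"
    proof (cases "K = {}")
      case True
      then have "(\<Sum>I\<in>Q. 2 ^ haar_level I * indicator (haar_support I) x) = (0 :: real)"
        by (intro sum.neutral) (auto simp: K_def)
      then show ?thesis by (simp add: sum_nonneg)
    next
      case False
      define n where "n = Max (haar_level ` K)"
      have "n \<in> haar_level ` K" using K False by (auto simp: n_def)
      then obtain I\<^sub>0 where I0: "I\<^sub>0 \<in> K" "haar_level I\<^sub>0 = n" by blast
      then have I0Q: "I\<^sub>0 \<in> Q" "x \<in> haar_support I\<^sub>0" by (auto simp: K_def)
      have "(\<Sum>I\<in>Q. 2 ^ haar_level I * indicator (haar_support I) x) = (\<Sum>I\<in>K. 2 ^ haar_level I :: real)"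
        using Q by (intro sum.mono_neutral_cong_right) (auto simp: K_def indicator_def)
      \<comment> \<open>The chain estimate with ratio 2 in place of \<open>2 powr (1 / p)\<close>.
        It is the source of the factor 2 in the conclusion.\<close>
      also have "\<dots> \<le> 2 / (2 - 1) * 2 ^ n"
        by (rule sum_chain_le[of _ _ x]) (use K in \<open>auto simp: K_def n_def\<close>)
      finally have "\<mu> powr p * (\<Sum>I\<in>Q. 2 ^ haar_level I * indicator (haar_support I) x) \<le> \<mu> powr p * (2 * 2 ^ n)"
        by (intro mult_left_mono) auto
      also have "\<dots> = 2 * (\<mu> * z ^ n) powr p"
        using z \<open>0 \<le> \<mu>\<close> by (simp add: powr_mult zn)
      also have "(\<mu> * z ^ n) powr p \<le> \<bar>haar_coeff h I\<^sub>0 * haar I\<^sub>0 x\<bar> powr p"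
      proof (intro powr_mono2)
        show "\<mu> * z ^ n \<le> \<bar>haar_coeff h I\<^sub>0 * haar I\<^sub>0 x\<bar>"
          using \<mu>[OF I0Q(1)] I0Q I0 Q(2) z by (subst abs_haar_term[OF p]) (auto simp: z_def)
      qed (use p z \<open>0 \<le> \<mu>\<close> in auto)
      finally have "2 ^ card Q * (\<mu> powr p * (\<Sum>I\<in>Q. 2 ^ haar_level I * indicator (haar_support I) x))
          \<le> 2 ^ card Q * (2 * \<bar>haar_coeff h I\<^sub>0 * haar I\<^sub>0 x\<bar> powr p)"
        by (intro mult_left_mono) auto
      also have "\<dots> \<le> 2 * (\<Sum>S\<in>Pow Q. \<bar>T S x\<bar> powr p)"
        using sum_signs_ge[OF p Q(1) I0Q(1), of "\<lambda>I. haar_coeff h I * haar I x"]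
        by (simp add: T_def mult.assoc)
      finally show ?thesis .
    qed
  qed
  also have "\<dots> = 2 * (\<Sum>S\<in>Pow Q. LINT x|unit_measure. \<bar>T S x\<bar> powr p)"
    by (simp add: Bochner_Integration.integral_sum[OF int])
  also have "\<dots> \<le> 2 * (\<Sum>S\<in>Pow Q. ?R)"
    unfolding T_def by (intro mult_left_mono sum_mono haar_multiplier p h Q) auto
  also have "\<dots> = 2 ^ card Q * (2 * ?R)"
    using Q by (simp add: card_Pow)
  finally show ?thesis by simp
qed

section \<open>Minkowski's inequality and the greedy error\<close>

lemma Lp_norm_nonneg: "0 \<le> Lp_norm p f"
  by (simp add: Lp_norm_def)

lemma Lp_norm_powr: "1 < p \<Longrightarrow> Lp_norm p f powr p = (LINT x|unit_measure. \<bar>f x\<bar> powr p)"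
  by (simp add: Lp_norm_def powr_powr)

lemma Lp_norm_leI:
  assumes "1 < p" "0 \<le> M" "(LINT x|unit_measure. \<bar>f x\<bar> powr p) \<le> M powr p"
  shows "Lp_norm p f \<le> M"
proof -
  have "(LINT x|unit_measure. \<bar>f x\<bar> powr p) powr (1 / p) \<le> (M powr p) powr (1 / p)"
    using assms by (intro powr_mono2) auto
  then show ?thesis using assms by (simp add: Lp_norm_def powr_powr)
qed

text \<open>Minkowski's inequality: \<open>(u + v) / (A + B)\<close> is a convex combination of
  \<open>u / A\<close> and \<open>v / B\<close>, and integrating the convexity inequality gives the
  claim. The margin \<open>e\<close> keeps \<open>A\<close> and \<open>B\<close> positive even when
  a norm is 0.\<close>

lemma Lp_norm_add_le:
  assumes p: "1 < p" and f: "f \<in> Lp_space p" and g: "g \<in> Lp_space p"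
  shows "Lp_norm p (\<lambda>x. f x + g x) \<le> Lp_norm p f + Lp_norm p g"
proof (rule field_le_epsilon)
  fix e :: real assume "0 < e"
  define A where "A = Lp_norm p f + e / 2"
  define B where "B = Lp_norm p g + e / 2"
  have AB: "0 < A" "0 < B" "Lp_norm p f \<le> A" "Lp_norm p g \<le> B"
    using Lp_norm_nonneg[of p f] Lp_norm_nonneg[of p g] \<open>0 < e\<close> by (auto simp: A_def B_def)
  define s where "s = A / (A + B)"
  have s: "0 \<le> s" "0 \<le> 1 - s" "1 - s = B / (A + B)" using AB by (auto simp: s_def field_simps)
  have convex: "\<bar>s * u + (1 - s) * v\<bar> powr p \<le> s * \<bar>u\<bar> powr p + (1 - s) * \<bar>v\<bar> powr p" for u v
  proof -
    define w where "w = s * u + (1 - s) * v"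
    obtain m where m: "\<And>y. \<bar>w\<bar> powr p + m * (y - w) \<le> \<bar>y\<bar> powr p"
      using abs_powr_supporting_line[OF p, of w] by blast
    have "s * (\<bar>w\<bar> powr p + m * (u - w)) + (1 - s) * (\<bar>w\<bar> powr p + m * (v - w))
        \<le> s * \<bar>u\<bar> powr p + (1 - s) * \<bar>v\<bar> powr p"
      by (intro add_mono mult_left_mono m s)
    moreover have "s * (\<bar>w\<bar> powr p + m * (u - w)) + (1 - s) * (\<bar>w\<bar> powr p + m * (v - w)) = \<bar>w\<bar> powr p"
      by (simp add: w_def algebra_simps)
    ultimately show ?thesis by (simp add: w_def)
  qed
  have pointwise: "\<bar>u + v\<bar> powr p \<le> (A + B) powr p * (s / A powr p * \<bar>u\<bar> powr p + (1 - s) / B powr p * \<bar>v\<bar> powr p)"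
    for u v
  proof -
    have "s * (u / A) + (1 - s) * (v / B) = (u + v) / (A + B)"
      unfolding s(3) using AB by (simp add: s_def add_divide_distrib)
    then have "\<bar>(u + v) / (A + B)\<bar> powr p \<le> s * \<bar>u / A\<bar> powr p + (1 - s) * \<bar>v / B\<bar> powr p"
      using convex[of "u / A" "v / B"] by simp
    also have "\<dots> = s / A powr p * \<bar>u\<bar> powr p + (1 - s) / B powr p * \<bar>v\<bar> powr p"
      using AB by (simp add: abs_divide powr_divide)
    finally have "(A + B) powr p * \<bar>(u + v) / (A + B)\<bar> powr p
        \<le> (A + B) powr p * (s / A powr p * \<bar>u\<bar> powr p + (1 - s) / B powr p * \<bar>v\<bar> powr p)"
      by (intro mult_left_mono) auto
    moreover have "(A + B) powr p * \<bar>(u + v) / (A + B)\<bar> powr p = \<bar>u + v\<bar> powr p"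
      using AB by (simp add: abs_divide powr_divide)
    ultimately show ?thesis by simp
  qed
  have int: "integrable unit_measure (\<lambda>x. \<bar>f x\<bar> powr p)" "integrable unit_measure (\<lambda>x. \<bar>g x\<bar> powr p)"
    "integrable unit_measure (\<lambda>x. \<bar>f x + g x\<bar> powr p)"
    using f g Lp_space_add[OF p f g] by (auto intro: Lp_space_integrable_powr)
  have "(LINT x|unit_measure. \<bar>f x + g x\<bar> powr p) \<le> (LINT x|unit_measure.
      (A + B) powr p * (s / A powr p * \<bar>f x\<bar> powr p + (1 - s) / B powr p * \<bar>g x\<bar> powr p))"
    by (intro integral_mono int integrable_mult_right Bochner_Integration.integrable_add pointwise)
  also have "\<dots> = (A + B) powr p * (s / A powr p * Lp_norm p f powr p + (1 - s) / B powr p * Lp_norm p g powr p)"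
    using p by (simp add: int Lp_norm_powr)
  also have "\<dots> \<le> (A + B) powr p * (s / A powr p * A powr p + (1 - s) / B powr p * B powr p)"
    using AB s p Lp_norm_nonneg by (intro mult_left_mono add_mono powr_mono2) auto
  also have "\<dots> = (A + B) powr p" using AB by simp
  finally have "Lp_norm p (\<lambda>x. f x + g x) \<le> A + B"
    using AB by (intro Lp_norm_leI[OF p]) auto
  then show "Lp_norm p (\<lambda>x. f x + g x) \<le> Lp_norm p f + Lp_norm p g + e"
    by (simp add: A_def B_def)
qed

lemma greedy_error_le:
  fixes p :: real and g :: "real \<Rightarrow> real"
  assumes p: "1 < p" and g: "g \<in> Lp_space p" and greedy: "greedy_set p g m \<Lambda>"
    and B: "B \<subseteq> dyadic_intervals" "finite B" "card B = m"
  shows "Lp_norm p (\<lambda>x. g x - greedy_approx g \<Lambda> x)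
    \<le> (2 + 1 / (1 - (1 / 2) powr (1 / p))\<^sup>2) * (max p (p / (p - 1)) - 1)\<^sup>2
        * Lp_norm p (\<lambda>x. g x - (\<Sum>I\<in>B. a I * haar I x))"
proof -
  define C where "C = max p (p / (p - 1)) - 1"
  define z where "z = 2 powr (1 / p)"
  define h where "h x = g x - (\<Sum>I\<in>B. a I * haar I x)" for x
  define X where "X = Lp_norm p h"
  define D where "D = \<Lambda> \<union> B"
  have \<Lambda>: "\<Lambda> \<subseteq> dyadic_intervals" "finite \<Lambda>" "card \<Lambda> = m"
    and max: "\<And>I J. I \<in> \<Lambda> \<Longrightarrow> J \<in> dyadic_intervals - \<Lambda> \<Longrightarrow> haar_coeff_norm p g J \<le> haar_coeff_norm p g I"
    using greedy by (auto simp: greedy_set_def)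
  \<comment> \<open>Used at the end to replace 1 and \<open>C\<close> by
    \<open>C\<^sup>2\<close>.\<close>
  have C: "1 \<le> C"
  proof (cases "2 \<le> p")
    case False
    then have "2 \<le> p / (p - 1)" using p by (simp add: le_divide_eq)
    then show ?thesis by (simp add: C_def)
  qed (simp add: C_def)
  have z: "1 < z" "z \<le> 2" "z powr p = 2"
    using p powr_mono[of "1 / p" 1 2] by (auto simp: z_def powr_powr)
  have h: "h \<in> Lp_space p" unfolding h_def by (rule Lp_space_diff_haar_sum[OF p g])
  have X: "0 \<le> X" "(LINT x|unit_measure. \<bar>h x\<bar> powr p) = X powr p"
    using p by (auto simp: X_def Lp_norm_nonneg Lp_norm_powr)
  have D: "finite D" "D \<subseteq> dyadic_intervals" using \<Lambda> B by (auto simp: D_def)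
  have coeff: "haar_coeff h I = haar_coeff g I - (if I \<in> B then a I else 0)" if "I \<in> dyadic_intervals" for I
  proof -
    have "(\<lambda>x. \<Sum>I\<in>B. a I * haar I x) \<in> Lp_space p"
      using p by (intro Lp_space_sum Lp_space_cmult haar_Lp)
    then have "haar_coeff h I = haar_coeff g I - haar_coeff (\<lambda>x. \<Sum>I\<in>B. a I * haar I x) I"
      unfolding h_def using that g by (intro haar_coeff_diff Lp_space_integrable[OF p])
    then show ?thesis using haar_coeff_haar_sum[OF B(2,1) that, of a] by simp
  qed
  \<comment> \<open>In the decomposition of the error, \<open>u\<close> is the negative of the
    projection of \<open>h\<close> on \<open>\<Lambda> \<union> B\<close>, and \<open>v\<close> is
    the projection of \<open>g\<close> on \<open>B - \<Lambda>\<close>.\<close>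
  define u where "u x = (\<Sum>I\<in>D. - 1 * haar_coeff h I * haar I x)" for x
  define v where "v x = (\<Sum>I\<in>B - \<Lambda>. haar_coeff g I * haar I x)" for x
  have u: "u \<in> Lp_space p" and v: "v \<in> Lp_space p"
    unfolding u_def v_def using p by (intro Lp_space_sum Lp_space_cmult haar_Lp; assumption)+
  have split: "g x - greedy_approx g \<Lambda> x = h x + u x + v x" for x
  proof -
    have "u x = (\<Sum>I\<in>D. (if I \<in> B then a I else 0) * haar I x - haar_coeff g I * haar I x)"
      unfolding u_def using D(2) by (intro sum.cong refl) (auto simp: coeff algebra_simps)
    also have "\<dots> = (\<Sum>I\<in>D. (if I \<in> B then a I else 0) * haar I x) - (\<Sum>I\<in>D. haar_coeff g I * haar I x)"
      by (rule sum_subtractf)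
    also have "(\<Sum>I\<in>D. (if I \<in> B then a I else 0) * haar I x) = (\<Sum>I\<in>B. a I * haar I x)"
      using D(1) by (intro sum.mono_neutral_cong_right) (auto simp: D_def)
    also have "(\<Sum>I\<in>D. haar_coeff g I * haar I x) = greedy_approx g \<Lambda> x + v x"
      unfolding greedy_approx_def v_def D_def using \<Lambda> B
      by (subst sum.union_disjoint[symmetric]) (auto intro!: sum.cong)
    finally show ?thesis by (simp add: h_def)
  qed
  have u_le: "Lp_norm p u \<le> C * X"
  proof (rule Lp_norm_leI[OF p])
    show "(LINT x|unit_measure. \<bar>u x\<bar> powr p) \<le> (C * X) powr p"
      using haar_multiplier[OF p h _ D, of "\<lambda>_. - 1"] C X by (simp add: u_def C_def powr_mult)
  qed (use C X in auto)
  have v_le: "Lp_norm p v \<le> (z / (z - 1))\<^sup>2 * (C * X)"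
  proof (rule Lp_norm_leI[OF p])
    have card: "card (B - \<Lambda>) = card (\<Lambda> - B)"
      using \<Lambda> B by (metis card_Diff_subset_Int finite_Int inf_commute)
    \<comment> \<open>The factor 2 is \<open>z powr p\<close>, so it turns into a factor
      \<open>z\<close> for the norm.\<close>
    have "(LINT x|unit_measure. \<bar>v x\<bar> powr p) \<le> (z / (z - 1)) powr p * (2 * (C powr p * X powr p))"
    proof (cases "B - \<Lambda> = {}")
      case True
      then have "v x = 0" for x unfolding v_def by (simp only: sum.empty)
      then show ?thesis by simp
    next
      case False
      \<comment> \<open>The largest term of \<open>g\<close> that the greedy choice leaves out among
        the indices of \<open>B\<close>. By greediness every term of \<open>g\<close> with index in
        \<open>\<Lambda>\<close> is at least as large.\<close>
      define \<mu> where "\<mu> = Max (haar_coeff_norm p g ` (B - \<Lambda>))"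
      have "\<mu> \<in> haar_coeff_norm p g ` (B - \<Lambda>)" using False B by (auto simp: \<mu>_def)
      then obtain J where J: "J \<in> B - \<Lambda>" "\<mu> = haar_coeff_norm p g J" by blast
      have "0 \<le> \<mu>" by (simp add: J haar_coeff_norm_nonneg)
      have "(LINT x|unit_measure. \<bar>v x\<bar> powr p) \<le> (z / (z - 1)) powr p * (\<mu> powr p * real (card (\<Lambda> - B)))"
        unfolding v_def z_def card[symmetric] using B \<open>0 \<le> \<mu>\<close>
        by (intro haar_sum_upper[OF p]) (auto simp: \<mu>_def)
      also have "\<mu> powr p * real (card (\<Lambda> - B)) \<le> 2 * (C powr p * X powr p)"
        unfolding C_def X(2)[symmetric]
      proof (rule haar_sum_lower[OF p h])
        fix I assume I: "I \<in> \<Lambda> - B"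
        then have "haar_coeff h I = haar_coeff g I" using \<Lambda>(1) by (subst coeff) auto
        then have "haar_coeff_norm p h I = haar_coeff_norm p g I" by (simp add: haar_coeff_norm_def)
        then show "\<mu> \<le> haar_coeff_norm p h I" using max[of I J] I J B(1) by auto
      qed (use \<Lambda> \<open>0 \<le> \<mu>\<close> in auto)
      finally show ?thesis by (simp add: mult_left_mono)
    qed
    also have "\<dots> = (z / (z - 1) * z * (C * X)) powr p"
      by (simp only: powr_mult z(3) mult.assoc)
    also have "\<dots> \<le> ((z / (z - 1))\<^sup>2 * (C * X)) powr p"
    proof (intro powr_mono2 mult_right_mono)
      have "z \<le> z / (z - 1)" using z by (simp add: le_divide_eq)
      then show "z / (z - 1) * z \<le> (z / (z - 1))\<^sup>2"
        unfolding power2_eq_square using z by (intro mult_left_mono) auto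
    qed (use z C X p in auto)
    finally show "(LINT x|unit_measure. \<bar>v x\<bar> powr p) \<le> ((z / (z - 1))\<^sup>2 * (C * X)) powr p" .
  qed (use C X in auto)
  have "Lp_norm p (\<lambda>x. g x - greedy_approx g \<Lambda> x) \<le> Lp_norm p (\<lambda>x. h x + u x) + Lp_norm p v"
    unfolding split by (intro Lp_norm_add_le Lp_space_add p h u v)
  also have "\<dots> \<le> X + Lp_norm p u + Lp_norm p v"
    unfolding X_def by (intro add_right_mono Lp_norm_add_le p h u)
  also have "\<dots> \<le> (1 + C + (z / (z - 1))\<^sup>2 * C) * X"
    using u_le v_le by (simp add: algebra_simps)
  also have "\<dots> \<le> (C\<^sup>2 + C\<^sup>2 + (z / (z - 1))\<^sup>2 * C\<^sup>2) * X"
    using C X self_le_power[of C 2] one_le_power[of C 2]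
    by (intro mult_right_mono add_mono mult_left_mono) auto
  also have "z / (z - 1) = 1 / (1 - (1 / 2) powr (1 / p))"
    using z by (simp add: z_def powr_divide divide_simps)
  finally show ?thesis
    by (simp add: C_def X_def h_def[abs_def] power_divide algebra_simps)
qed

theorem theorem1p1:
  fixes p :: real and g :: "real \<Rightarrow> real" and m :: nat and \<Lambda> :: "haar_index set"
  assumes "1 < p"
    and "g \<in> Lp_space p"
    and "greedy_set p g m \<Lambda>"
  shows "Lp_norm p (\<lambda>x. g x - greedy_approx g \<Lambda> x)
    \<le> (2 + 1 / (1 - (1 / 2) powr (1 / p))\<^sup>2) * (max p (p / (p - 1)) - 1)\<^sup>2
        * best_mterm_error p m g"
proof -
  define K where "K = (2 + 1 / (1 - (1 / 2) powr (1 / p))\<^sup>2) * (max p (p / (p - 1)) - 1)\<^sup>2"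
  define E where "E = {Lp_norm p (\<lambda>x. g x - (\<Sum>I\<in>B. a I * haar I x)) | B a.
    B \<subseteq> dyadic_intervals \<and> finite B \<and> card B = m}"
  have "2 \<le> max p (p / (p - 1))"
    using assms(1) by (cases "2 \<le> p") (auto simp: le_max_iff_disj le_divide_eq)
  then have K: "0 < K"
    unfolding K_def by (intro mult_pos_pos add_pos_nonneg zero_less_power) auto
  \<comment> \<open>After division by the positive \<open>K\<close>, the estimate for each
    competitor says that the left side is a lower bound of \<open>E\<close>. The set is nonempty
    because \<open>\<Lambda>\<close> itself has \<open>m\<close> elements.\<close>
  have "Lp_norm p (\<lambda>x. g x - greedy_approx g \<Lambda> x) / K \<le> Inf E"
  proof (rule cInf_greatest)
    show "E \<noteq> {}" using assms(3) by (auto simp: E_def greedy_set_def)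
    fix e assume "e \<in> E"
    then show "Lp_norm p (\<lambda>x. g x - greedy_approx g \<Lambda> x) / K \<le> e"
      using greedy_error_le[OF assms] K by (auto simp: E_def K_def divide_le_eq mult.commute)
  qed
  then have "Lp_norm p (\<lambda>x. g x - greedy_approx g \<Lambda> x) \<le> K * Inf E"
    using K by (simp add: divide_le_eq mult.commute)
  then show ?thesis unfolding K_def E_def best_mterm_error_def .
qed

end
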